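(* Let $\mathcal{A}$ be a unital $C^*$-algebra. Then $\widehat{\mathcal{M}\Phi}_-^+(H_{\mathcal{A}})$ is open in $B^a(H_{\mathcal{A}})$ (in the norm topology).
   Context: $\mathcal{A}$ is a unital $C^*$-algebra; $H_{\mathcal{A}}$ is the standard countably generated (right) Hilbert $\mathcal{A}$-module; $B^a(H_{\mathcal{A}})$ is the set of bounded adjointable operators on $H_{\mathcal{A}}$. $\tilde\oplus$ denotes the internal direct sum of closed submodules, not necessarily orthogonal. A Hilbert module is finitely generated if it equals the $\mathcal{A}$-linear span of a finite subset. "Isomorphism" between closed submodules means a bounded bijective $\mathcal{A}$-linear map (with bounded inverse). "Projection" means a not necessarily orthogonal (skew) projection, i.e. an idempotent. "$D$ has matrix $\begin{bmatrix}D_1&0\\0&D_4\end{bmatrix}$ with respect to the decomposition $H_{\mathcal{A}}=M_1'\tilde\oplus N_1'\stackrel{D}{\longrightarrow}M_2'\tilde\oplus N_2'=H_{\mathcal{A}}$" means that $D(M_1')\subseteq M_2'$, $D(N_1')\subseteq N_2'$, $D_1=D_{|M_1'}:M_1'\to M_2'$ and $D_4=D_{|N_1'}:N_1'\to N_2'$; here all four submodules are closed. $\widehat{\mathcal{M}\Phi}_-^+(H_{\mathcal{A}})$ is the set of all $D\in B^a(H_{\mathcal{A}})$ for which there is a decomposition $H_{\mathcal{A}}=M_1'\tilde\oplus N_1'\stackrel{D}{\longrightarrow}M_2'\tilde\oplus N_2'=H_{\mathcal{A}}$ with respect to which $D$ has matrix $\begin{bmatrix}D_1&0\\0&D_4\end{bmatrix}$,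 where $D_1$ is an isomorphism, $N_2'$ is finitely generated, and $H_{\mathcal{A}}=M_1'\tilde\oplus N\tilde\oplus N_2'$ for some closed submodule $N$, where the projection onto $M_1'\tilde\oplus N$ along $N_2'$ is adjointable. *)

theory Defs
  imports "HOL-Analysis.Analysis" "HOL-Library.Function_Algebras"
begin

text \<open>
  Unital \<open>C\<^sup>*\<close>-algebras as a type class. The base class is \<open>monoid_mult\<close> rather than \<open>ring_1\<close>,
  so that the zero algebra is not excluded.
\<close>

class unital_cstar_algebra = real_normed_algebra + banach + monoid_mult +
  fixes scaleC :: "complex \<Rightarrow> 'a \<Rightarrow> 'a"
    and star :: "'a \<Rightarrow> 'a"
  assumes scaleC_of_real: "scaleC (complex_of_real r) x = scaleR r x"
    and scaleC_add_right: "scaleC c (x + y) = scaleC c x + scaleC c y"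
    and scaleC_add_left: "scaleC (c + d) x = scaleC c x + scaleC d x"
    and scaleC_scaleC: "scaleC c (scaleC d x) = scaleC (c * d) x"
    and mult_scaleC_left: "scaleC c x * y = scaleC c (x * y)"
    and mult_scaleC_right: "x * scaleC c y = scaleC c (x * y)"
    and norm_scaleC: "norm (scaleC c x) = cmod c * norm x"
    and star_star: "star (star x) = x"
    and star_add: "star (x + y) = star x + star y"
    and star_mult: "star (x * y) = star y * star x"
    and star_scaleC: "star (scaleC c x) = scaleC (cnj c) (star x)"
    and cstar_identity: "norm (star x * x) = (norm x)\<^sup>2"

subsection \<open>The standard Hilbert module\<close>

text \<open>
  \<open>HA\<close> is \<open>l\<^sup>2(\<A>)\<close>. Summability is norm convergence of the partial sums, and the
  inner product is linear in its second argument. Addition, zero and finite sums of sequences are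
  the pointwise ones of \<^theory>\<open>HOL-Library.Function_Algebras\<close>. Since \<open>\<A>\<close> is unital,
  complex scalars act through the right action of \<open>scaleC c 1\<close>, so submodules are complex
  subspaces and \<open>\<A>\<close>-linear maps are complex linear.
\<close>

definition HA :: "(nat \<Rightarrow> 'a::unital_cstar_algebra) set" where
  "HA = {x. summable (\<lambda>n. star (x n) * x n)}"

definition ract :: "(nat \<Rightarrow> 'a::unital_cstar_algebra) \<Rightarrow> 'a \<Rightarrow> (nat \<Rightarrow> 'a)" where
  "ract x a = (\<lambda>n. x n * a)"

definition inner_HA :: "(nat \<Rightarrow> 'a::unital_cstar_algebra) \<Rightarrow> (nat \<Rightarrow> 'a) \<Rightarrow> 'a" where
  "inner_HA x y = (\<Sum>n. star (x n) * y n)"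

definition norm_HA :: "(nat \<Rightarrow> 'a::unital_cstar_algebra) \<Rightarrow> real" where
  "norm_HA x = sqrt (norm (inner_HA x x))"

definition HA_topology :: "(nat \<Rightarrow> 'a::unital_cstar_algebra) topology" where
  "HA_topology = Metric_space.mtopology HA (\<lambda>x y. norm_HA (x - y))"

definition closed_submodule :: "(nat \<Rightarrow> 'a::unital_cstar_algebra) set \<Rightarrow> bool" where
  "closed_submodule M \<longleftrightarrow>
     M \<subseteq> HA \<and> 0 \<in> M \<and> (\<forall>x\<in>M. \<forall>y\<in>M. x + y \<in> M) \<and> (\<forall>x\<in>M. \<forall>a. ract x a \<in> M) \<and>
     closedin HA_topology M"

text \<open>\<open>direct_sum M N K\<close>: \<open>K\<close> is the internal (not necessarily orthogonal) direct sum of the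
  closed submodules \<open>M\<close> and \<open>N\<close>.\<close>

definition direct_sum ::
  "(nat \<Rightarrow> 'a::unital_cstar_algebra) set \<Rightarrow> (nat \<Rightarrow> 'a) set \<Rightarrow> (nat \<Rightarrow> 'a) set \<Rightarrow> bool" where
  "direct_sum M N K \<longleftrightarrow>
     closed_submodule M \<and> closed_submodule N \<and> M \<inter> N = {0} \<and> K = {x + y |x y. x \<in> M \<and> y \<in> N}"

definition finitely_generated :: "(nat \<Rightarrow> 'a::unital_cstar_algebra) set \<Rightarrow> bool" where
  "finitely_generated N \<longleftrightarrow>
     (\<exists>F. finite F \<and> F \<subseteq> N \<and> N = {\<Sum>f\<in>F. ract f (c f) |c. True})"

subsection \<open>Operators\<close>

definition A_linear_on ::
  "(nat \<Rightarrow> 'a::unital_cstar_algebra) set \<Rightarrow> ((nat \<Rightarrow> 'a) \<Rightarrow> (nat \<Rightarrow> 'a)) \<Rightarrow> bool" where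
  "A_linear_on M T \<longleftrightarrow>
     (\<forall>x\<in>M. \<forall>y\<in>M. T (x + y) = T x + T y) \<and> (\<forall>x\<in>M. \<forall>a. T (ract x a) = ract (T x) a)"

definition bounded_on ::
  "(nat \<Rightarrow> 'a::unital_cstar_algebra) set \<Rightarrow> ((nat \<Rightarrow> 'a) \<Rightarrow> (nat \<Rightarrow> 'a)) \<Rightarrow> bool" where
  "bounded_on M T \<longleftrightarrow> (\<exists>C. \<forall>x\<in>M. norm_HA (T x) \<le> C * norm_HA x)"

text \<open>\<open>Ba\<close> is \<open>B\<^sup>a(H\<^sub>\<A>)\<close>; operators are extensional functions on \<open>HA\<close>, so that equality of
  functions is equality of operators.\<close>

definition Ba :: "((nat \<Rightarrow> 'a::unital_cstar_algebra) \<Rightarrow> (nat \<Rightarrow> 'a)) set" where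
  "Ba = {T \<in> HA \<rightarrow>\<^sub>E HA. A_linear_on HA T \<and> bounded_on HA T \<and>
           (\<exists>S \<in> HA \<rightarrow> HA. \<forall>x\<in>HA. \<forall>y\<in>HA. inner_HA (T x) y = inner_HA x (S y))}"

text \<open>The supremum is taken in \<^typ>\<open>ennreal\<close> only to make the distance nonnegative for arbitrary
  functions too, as \<^locale>\<open>Metric_space\<close> demands; on \<open>Ba\<close> it is the finite operator norm.\<close>

definition opnorm :: "((nat \<Rightarrow> 'a::unital_cstar_algebra) \<Rightarrow> (nat \<Rightarrow> 'a)) \<Rightarrow> real" where
  "opnorm T = enn2real (SUP x\<in>{x \<in> HA. norm_HA x \<le> 1}. ennreal (norm_HA (T x)))"

definition Ba_topology :: "((nat \<Rightarrow> 'a::unital_cstar_algebra) \<Rightarrow> (nat \<Rightarrow> 'a)) topology" where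
  "Ba_topology = Metric_space.mtopology Ba (\<lambda>S T. opnorm (S - T))"

definition module_iso ::
  "((nat \<Rightarrow> 'a::unital_cstar_algebra) \<Rightarrow> (nat \<Rightarrow> 'a)) \<Rightarrow> (nat \<Rightarrow> 'a) set \<Rightarrow> (nat \<Rightarrow> 'a) set \<Rightarrow> bool"
where
  "module_iso T M N \<longleftrightarrow>
     A_linear_on M T \<and> bij_betw T M N \<and> bounded_on M T \<and> bounded_on N (inv_into M T)"

text \<open>\<open>P\<close> is the (skew) projection onto \<open>K\<close> along \<open>L\<close>. A linear idempotent is determined by its
  range and kernel.\<close>

definition projection_onto_along ::
  "((nat \<Rightarrow> 'a::unital_cstar_algebra) \<Rightarrow> (nat \<Rightarrow> 'a)) \<Rightarrow> (nat \<Rightarrow> 'a) set \<Rightarrow> (nat \<Rightarrow> 'a) set \<Rightarrow> bool"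
where
  "projection_onto_along P K L \<longleftrightarrow>
     A_linear_on HA P \<and> (\<forall>x\<in>HA. P (P x) = P x) \<and> P ` HA = K \<and> {x \<in> HA. P x = 0} = L"

definition diagonal_decomposition ::
  "((nat \<Rightarrow> 'a::unital_cstar_algebra) \<Rightarrow> (nat \<Rightarrow> 'a)) \<Rightarrow> (nat \<Rightarrow> 'a) set \<Rightarrow> (nat \<Rightarrow> 'a) set \<Rightarrow>
     (nat \<Rightarrow> 'a) set \<Rightarrow> (nat \<Rightarrow> 'a) set \<Rightarrow> bool"
where
  "diagonal_decomposition D M\<^sub>1 N\<^sub>1 M\<^sub>2 N\<^sub>2 \<longleftrightarrow>
     direct_sum M\<^sub>1 N\<^sub>1 HA \<and> direct_sum M\<^sub>2 N\<^sub>2 HA \<and> D ` M\<^sub>1 \<subseteq> M\<^sub>2 \<and> D ` N\<^sub>1 \<subseteq> N\<^sub>2"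

text \<open>\<open>MPhi_hat_minus_plus\<close> is the class written M-Phi with a hat, lower index minus and upper
  index plus. The set \<open>K\<close> below is the direct sum of \<open>M\<^sub>1\<close> and \<open>N\<close>.\<close>

definition MPhi_hat_minus_plus :: "((nat \<Rightarrow> 'a::unital_cstar_algebra) \<Rightarrow> (nat \<Rightarrow> 'a)) set" where
  "MPhi_hat_minus_plus =
     {D \<in> Ba. \<exists>M\<^sub>1 N\<^sub>1 M\<^sub>2 N\<^sub>2.
        diagonal_decomposition D M\<^sub>1 N\<^sub>1 M\<^sub>2 N\<^sub>2 \<and> module_iso D M\<^sub>1 M\<^sub>2 \<and> finitely_generated N\<^sub>2 \<and>
        (\<exists>N K. direct_sum M\<^sub>1 N K \<and> direct_sum K N\<^sub>2 HA \<and>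
               (\<exists>P\<in>Ba. projection_onto_along P K N\<^sub>2))}"

end

theory Submission
  imports Defs
begin

text \<open>
  Let \<open>D\<^sub>0\<close> belong to the class, witnessed by \<open>M\<^sub>1\<close>, \<open>N\<^sub>1\<close>, \<open>M\<^sub>2\<close>, \<open>N\<^sub>2\<close>, \<open>N\<close> and the
  projection \<open>P\<close>. The conditions on \<open>N\<close>, \<open>P\<close> and finite generation mention only \<open>M\<^sub>1\<close> and
  \<open>N\<^sub>2\<close>. So it suffices, for \<open>D\<close> near \<open>D\<^sub>0\<close>, to diagonalise \<open>D\<close> while keeping these two
  submodules; only the other two move. Let \<open>Q\<close> be the projection onto \<open>M\<^sub>2\<close> along \<open>N\<^sub>2\<close>. As
  \<open>D\<^sub>0\<close> maps \<open>M\<^sub>1\<close> isomorphically onto \<open>M\<^sub>2\<close>, so does \<open>Q D\<close> for every \<open>D\<close> near \<open>D\<^sub>0\<close> (a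
  Neumann series or contraction argument, \<open>complement_perturbation\<close>). Hence \<open>D\<close> is bounded
  below on \<open>M\<^sub>1\<close>, its image \<open>D(M\<^sub>1)\<close> is a closed complement of \<open>N\<^sub>2\<close>, and the kernel of \<open>Q D\<close>,
  which is the preimage of \<open>N\<^sub>2\<close> under \<open>D\<close>, is a closed complement of \<open>M\<^sub>1\<close>. With respect to
  \<open>M\<^sub>1 \<oplus> D\<^sup>-\<^sup>1(N\<^sub>2) \<rightarrow> D(M\<^sub>1) \<oplus> N\<^sub>2\<close> the operator \<open>D\<close> is diagonal and its first entry is an
  isomorphism (\<open>module_iso_perturbation\<close>).

  The argument uses that \<open>Q\<close> is bounded, which follows from the Baire category theorem
  (\<open>complement_bounded\<close>), and that \<open>H\<^sub>\<A>\<close> is a Banach space. The norm of \<open>H\<^sub>\<A>\<close> satisfies the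
  triangle inequality by the Cauchy--Schwarz inequality for \<open>\<A>\<close>-valued inner products
  (\<open>cauchy_schwarz_finite\<close>), and this rests on the positivity of the elements \<open>star x * x\<close>
  (\<open>pos_star_mult_self\<close>). The latter is derived from the \<open>C\<^sup>*\<close>-identity by means of square
  roots given by the binomial series, without spectral theory.
\<close>

section \<open>Positive elements of a unital \<open>C\<^sup>*\<close>-algebra\<close>

lemma star_scaleR: "star (scaleR r (x::'a::unital_cstar_algebra)) = scaleR r (star x)"
  by (metis star_scaleC scaleC_of_real complex_cnj_complex_of_real)

lemma scaleC_minus_one: "scaleC (-1) x = - (x::'a::unital_cstar_algebra)"
  using scaleC_of_real[of "-1" x] by simp

lemma scaleC_minus_left: "scaleC (- c) x = - scaleC c (x::'a::unital_cstar_algebra)"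
  using scaleC_scaleC[of "-1" c x] by (simp add: scaleC_minus_one)

lemma scaleC_diff_right: "scaleC c (x - y) = scaleC c x - scaleC c (y::'a::unital_cstar_algebra)"
  using scaleC_add_right[of c "x - y" y] by simp

lemma star_zero [simp]: "star (0::'a::unital_cstar_algebra) = 0"
  using star_scaleR[of 0 "0::'a"] by simp

lemma star_minus: "star (- (x::'a::unital_cstar_algebra)) = - star x"
  using star_scaleR[of "-1" x] by simp

lemma star_diff: "star ((x::'a::unital_cstar_algebra) - y) = star x - star y"
  using star_add[of x "-y"] by (simp add: star_minus)

lemma star_one [simp]: "star (1::'a::unital_cstar_algebra) = 1"
  by (metis mult_1 mult_1_right star_mult star_star)

lemma norm_star [simp]: "norm (star (x::'a::unital_cstar_algebra)) = norm x"
proof -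
  have le: "norm y \<le> norm (star y)" for y :: 'a
  proof (cases "norm y = 0")
    case False
    have "norm y * norm y \<le> norm (star y) * norm y"
      using cstar_identity[of y] norm_mult_ineq[of "star y" y] by (simp add: power2_eq_square)
    then show ?thesis using False by simp
  qed simp
  show ?thesis using le[of x] le[of "star x"] by (simp add: star_star)
qed

lemma bounded_linear_star: "bounded_linear (star :: 'a::unital_cstar_algebra \<Rightarrow> 'a)"
  by (rule bounded_linear_intro[where K = 1]) (auto simp: star_add star_scaleR)

lemma star_sum: "star (\<Sum>i\<in>F. f i) = (\<Sum>i\<in>F. star (f i :: 'a::unital_cstar_algebra))"
  by (rule linear_sum[OF bounded_linear.linear[OF bounded_linear_star]])

lemma star_power: "star (x ^ n) = star (x::'a::unital_cstar_algebra) ^ n"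
  by (induction n) (simp_all add: star_mult power_commutes)

lemma norm_square_self_adjoint:
  "star (x::'a::unital_cstar_algebra) = x \<Longrightarrow> norm (x * x) = (norm x)\<^sup>2"
  using cstar_identity[of x] by simp

lemma norm_one_le: "norm (1::'a::unital_cstar_algebra) \<le> 1"
proof -
  have "norm (1::'a) = (norm (1::'a))\<^sup>2" using norm_square_self_adjoint[of "1::'a"] by simp
  then have "norm (1::'a) = 0 \<or> norm (1::'a) = 1" by (simp add: power2_eq_square)
  then show ?thesis by linarith
qed

lemma norm_power_le_one:
  assumes "norm (z::'a::unital_cstar_algebra) \<le> 1" shows "norm (z ^ k) \<le> 1"
proof (induction k)
  case (Suc k)
  have "norm (z * z ^ k) \<le> norm z * norm (z ^ k)" by (rule norm_mult_ineq)
  also have "\<dots> \<le> 1" using assms Suc by (simp add: mult_le_one)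
  finally show ?case by simp
qed (simp add: norm_one_le)

text \<open>
  The Taylor coefficients of \<open>sqrt (1 - z)\<close>. All except the first are nonpositive and their
  sum is nonnegative, so the series converges absolutely on the closed unit ball; this is what
  makes it available for every positive element, invertible or not.
\<close>

definition sqrt_coeff :: "nat \<Rightarrow> real" where
  "sqrt_coeff k = (1/2 gchoose k) * (-1) ^ k"

lemma sqrt_coeff_0 [simp]: "sqrt_coeff 0 = 1"
  by (simp add: sqrt_coeff_def)

lemma sqrt_coeff_Suc_nonpos: "sqrt_coeff (Suc k) \<le> 0"
proof -
  have "sqrt_coeff (Suc k) = pochhammer (- (1/2)) (Suc k) / fact (Suc k)"
    by (simp add: sqrt_coeff_def gbinomial_pochhammer power_mult_distrib[symmetric])
  also have "\<dots> = - (pochhammer (1/2) k / (2 * fact (Suc k)))"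
    by (simp add: pochhammer_rec)
  also have "\<dots> \<le> 0"
    by (simp add: pochhammer_nonneg del: fact_Suc)
  finally show ?thesis .
qed

lemma sqrt_coeff_sum_nonneg: "(\<Sum>k\<le>n. sqrt_coeff k) \<ge> 0"
proof -
  have "(\<Sum>k\<le>n. sqrt_coeff k) = (-1) ^ n * (- (1/2) gchoose n)"
    using gbinomial_sum_lower_neg[of "1/2::real" n] by (simp add: sqrt_coeff_def)
  also have "\<dots> = pochhammer (1/2) n / fact n"
    by (simp add: gbinomial_pochhammer power_mult_distrib[symmetric])
  also have "\<dots> \<ge> 0" by (simp add: pochhammer_nonneg)
  finally show ?thesis .
qed

lemma sqrt_coeff_abs_sum: "(\<Sum>k<n. \<bar>sqrt_coeff (Suc k)\<bar>) \<le> 1"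
proof -
  have "(\<Sum>k\<le>n. sqrt_coeff k) = 1 + (\<Sum>k<n. sqrt_coeff (Suc k))"
    by (simp add: sum.atMost_shift)
  moreover have "(\<Sum>k<n. \<bar>sqrt_coeff (Suc k)\<bar>) = - (\<Sum>k<n. sqrt_coeff (Suc k))"
    by (simp add: sum_negf[symmetric] sqrt_coeff_Suc_nonpos abs_of_nonpos)
  ultimately show ?thesis using sqrt_coeff_sum_nonneg[of n] by linarith
qed

lemma sqrt_coeff_summable: "summable (\<lambda>k. \<bar>sqrt_coeff (Suc k)\<bar>)"
  by (rule summableI_nonneg_bounded[where x = 1]) (auto simp: sqrt_coeff_abs_sum)

text \<open>
  By Vandermonde's identity, squaring the series gives the binomial series with exponent 1,
  that is \<open>1 - z\<close>.
\<close>

lemma sqrt_coeff_convolution: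
  "(\<Sum>i\<le>k. sqrt_coeff i * sqrt_coeff (k - i)) = (1 gchoose k) * (-1) ^ k"
proof -
  have "(\<Sum>i\<le>k. sqrt_coeff i * sqrt_coeff (k - i))
      = (\<Sum>i\<le>k. (1/2 gchoose i) * (1/2 gchoose (k - i)) * (-1) ^ k)"
  proof (rule sum.cong[OF refl])
    fix i assume "i \<in> {..k}"
    then have "(-1::real) ^ k = (-1) ^ i * (-1) ^ (k - i)" by (simp flip: power_add)
    then show "sqrt_coeff i * sqrt_coeff (k - i) = (1/2 gchoose i) * (1/2 gchoose (k - i)) * (-1) ^ k"
      by (simp add: sqrt_coeff_def)
  qed
  also have "\<dots> = (1 gchoose k) * (-1) ^ k"
    using gbinomial_Vandermonde[of "1/2::real" "1/2" k]
    by (simp add: sum_distrib_right[symmetric] atMost_atLeast0)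
  finally show ?thesis .
qed

text \<open>
  The bound on \<open>1 - b\<close> says that the square root is positive again in the sense defined below.
  Being a limit of polynomials in \<open>z\<close>, it inherits self-adjointness and commutes with
  everything that commutes with \<open>z\<close>.
\<close>

lemma sqrt_one_minus:
  fixes z :: "'a::unital_cstar_algebra"
  assumes "norm z \<le> 1"
  obtains b where "b * b = 1 - z" "norm (1 - b) \<le> 1" "star z = z \<Longrightarrow> star b = b"
    "\<And>w. w * z = z * w \<Longrightarrow> w * b = b * w"
proof -
  define f where "f k = sqrt_coeff k *\<^sub>R z ^ k" for k
  define b where "b = suminf f"
  have nf: "norm (f k) \<le> \<bar>sqrt_coeff k\<bar>" for k
    using norm_power_le_one[OF assms, of k] by (simp add: f_def mult_left_le)
  have sm: "summable (\<lambda>k. norm (f (Suc k)))"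
    by (rule summable_comparison_test'[OF sqrt_coeff_summable, of 0]) (use nf in auto)
  then have smf: "summable (\<lambda>k. norm (f k))" by (subst (asm) summable_Suc_iff)
  then have sf: "summable f" by (rule summable_norm_cancel)
  have head: "b = 1 + (\<Sum>k. f (Suc k))"
    using suminf_split_head[OF sf] by (simp add: b_def f_def)
  have n1: "norm (1 - b) \<le> 1"
  proof -
    have "norm (1 - b) = norm (\<Sum>k. f (Suc k))" by (simp add: head)
    also have "\<dots> \<le> (\<Sum>k. norm (f (Suc k)))" by (rule summable_norm[OF sm])
    also have "\<dots> \<le> 1"
    proof (rule suminf_le_const[OF sm])
      fix n
      have "(\<Sum>k<n. norm (f (Suc k))) \<le> (\<Sum>k<n. \<bar>sqrt_coeff (Suc k)\<bar>)"
        by (rule sum_mono) (rule nf)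
      then show "(\<Sum>k<n. norm (f (Suc k))) \<le> 1" using sqrt_coeff_abs_sum[of n] by linarith
    qed
    finally show ?thesis .
  qed
  have bb: "b * b = 1 - z"
  proof -
    have "b * b = (\<Sum>k. \<Sum>i\<le>k. f i * f (k - i))"
      unfolding b_def by (rule Cauchy_product[OF smf smf])
    also have "(\<lambda>k. \<Sum>i\<le>k. f i * f (k - i)) = (\<lambda>k. ((1 gchoose k) * (-1) ^ k) *\<^sub>R z ^ k)"
    proof
      fix k
      have "(\<Sum>i\<le>k. f i * f (k - i)) = (\<Sum>i\<le>k. (sqrt_coeff i * sqrt_coeff (k - i)) *\<^sub>R z ^ k)"
        by (rule sum.cong) (simp_all add: f_def flip: power_add)
      then show "(\<Sum>i\<le>k. f i * f (k - i)) = ((1 gchoose k) * (-1) ^ k) *\<^sub>R z ^ k"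
        by (simp add: scaleR_sum_left[symmetric] sqrt_coeff_convolution)
    qed
    also have "(\<Sum>k. ((1 gchoose k) * (-1) ^ k) *\<^sub>R z ^ k)
        = (\<Sum>k\<in>{0,1}. ((1 gchoose k) * (-1) ^ k) *\<^sub>R z ^ k)"
    proof (rule suminf_finite)
      fix k :: nat assume "k \<notin> {0, 1}"
      then have "(1::real) gchoose k = 0"
        using binomial_gbinomial[of 1 k, where ?'a = real] by (simp add: binomial_eq_0)
      then show "((1 gchoose k) * (-1) ^ k) *\<^sub>R z ^ k = 0" by simp
    qed simp
    also have "\<dots> = 1 - z" by simp
    finally show ?thesis .
  qed
  have sb: "star b = b" if "star z = z"
  proof -
    have "star b = (\<Sum>k. star (f k))"
      unfolding b_def by (rule bounded_linear.suminf[OF bounded_linear_star sf])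
    moreover have "star (f k) = f k" for k by (simp add: f_def star_scaleR star_power that)
    ultimately show ?thesis by (simp add: b_def)
  qed
  have wb: "w * b = b * w" if "w * z = z * w" for w
  proof -
    have "w * f k = f k * w" for k
      using power_commuting_commutes[OF that[symmetric], of k] by (simp add: f_def)
    then show ?thesis
      unfolding b_def by (simp add: suminf_mult[OF sf, symmetric] suminf_mult2[OF sf])
  qed
  show ?thesis by (rule that[OF bb n1 sb wb])
qed

text \<open>
  For a self-adjoint element, the norm condition says that the spectrum lies in \<open>[0, 2 * t]\<close>.
  In this form, closure under addition is the triangle inequality and square roots come from
  the binomial series.
\<close>

definition pos :: "'a::unital_cstar_algebra \<Rightarrow> bool" where
  "pos a \<longleftrightarrow> star a = a \<and> (\<exists>t\<ge>0. norm (t *\<^sub>R 1 - a) \<le> t)"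

lemma pos_add: assumes "pos a" "pos b" shows "pos (a + b)"
proof -
  obtain s t where st: "s \<ge> 0" "norm (s *\<^sub>R 1 - a) \<le> s" "t \<ge> 0" "norm (t *\<^sub>R 1 - b) \<le> t"
    using assms unfolding pos_def by blast
  have "norm ((s + t) *\<^sub>R 1 - (a + b)) \<le> s + t"
    using norm_triangle_ineq[of "s *\<^sub>R 1 - a" "t *\<^sub>R 1 - b"] st by (simp add: algebra_simps)
  moreover have "star (a + b) = a + b" using assms by (simp add: pos_def star_add)
  ultimately show ?thesis using st unfolding pos_def by (intro conjI exI[of _ "s + t"]) auto
qed

lemma pos_scaleR: assumes "pos a" "r \<ge> 0" shows "pos (r *\<^sub>R a)"
proof -
  obtain t where t: "t \<ge> 0" "norm (t *\<^sub>R 1 - a) \<le> t" using assms unfolding pos_def by blast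
  have "norm ((r * t) *\<^sub>R 1 - r *\<^sub>R a) = r * norm (t *\<^sub>R 1 - a)"
    using assms(2) by (simp flip: scaleR_scaleR scaleR_diff_right)
  also have "\<dots> \<le> r * t" using t assms by (simp add: mult_left_mono)
  finally show ?thesis using t assms unfolding pos_def
    by (intro conjI exI[of _ "r * t"]) (auto simp: star_scaleR)
qed

lemma pos_zero [simp]: "pos (0::'a::unital_cstar_algebra)"
  unfolding pos_def by (auto intro: exI[of _ 0])

lemma pos_sum: "(\<And>i. i \<in> F \<Longrightarrow> pos (f i)) \<Longrightarrow> pos (\<Sum>i\<in>F. f i)"
  by (induction F rule: infinite_finite_induct) (auto intro: pos_add)

lemma pos_sqrt:
  assumes "pos a"
  obtains b where "b * b = a" "pos b" "\<And>w. w * a = a * w \<Longrightarrow> w * b = b * w"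
proof -
  obtain t where t: "t \<ge> 0" "norm (t *\<^sub>R 1 - a) \<le> t" and a: "star a = a"
    using assms unfolding pos_def by blast
  show ?thesis
  proof (cases "t = 0")
    case True
    then show ?thesis using t by (intro that[of 0]) auto
  next
    case False
    define z where "z = 1 - a /\<^sub>R t"
    have za: "a = t *\<^sub>R (1 - z)" using False by (simp add: z_def)
    have "z = (t *\<^sub>R 1 - a) /\<^sub>R t" using False by (simp add: z_def scaleR_diff_right)
    then have "norm z = norm (t *\<^sub>R 1 - a) / t" using t(1) by (simp add: divide_inverse mult.commute)
    then have "norm z \<le> 1" using t False by simp
    moreover have "star z = z" by (simp add: z_def star_diff star_scaleR a)
    moreover have "w * z = z * w" if "w * a = a * w" for w
      using that by (simp add: z_def algebra_simps)
    ultimately obtain b where b: "b * b = 1 - z" "norm (1 - b) \<le> 1" "star b = b"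
      "\<And>w. w * a = a * w \<Longrightarrow> w * b = b * w"
      using sqrt_one_minus by metis
    have "norm (1 *\<^sub>R 1 - b) \<le> 1" using b(2) by simp
    then have pb: "pos b" unfolding pos_def using b(3) zero_le_one by blast
    show ?thesis
    proof (rule that[of "sqrt t *\<^sub>R b"])
      show "sqrt t *\<^sub>R b * sqrt t *\<^sub>R b = a" using b(1) t(1) by (simp add: za)
      show "pos (sqrt t *\<^sub>R b)" using pb t(1) by (simp add: pos_scaleR)
      show "w * sqrt t *\<^sub>R b = sqrt t *\<^sub>R b * w" if "w * a = a * w" for w
        using b(4)[OF that] by simp
    qed
  qed
qed

text \<open>
  The element \<open>u = b + \<i> c\<close> is normal with real part \<open>b\<close>, and \<open>star u * u\<close> is the sum of the
  squares. So the claim is that the real part of \<open>u\<close> has norm at most \<open>norm u\<close>.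
\<close>

lemma norm_square_le_commuting:
  fixes b c :: "'a::unital_cstar_algebra"
  assumes "star b = b" "star c = c" "b * c = c * b"
  shows "norm (b * b) \<le> norm (b * b + c * c)"
proof -
  define u where "u = b + scaleC \<i> c"
  have su: "star u = b - scaleC \<i> c"
    by (simp add: u_def star_add star_scaleC assms scaleC_minus_left)
  have "scaleC \<i> (scaleC \<i> (c * c)) = - (c * c)"
    by (simp add: scaleC_scaleC scaleC_minus_one)
  then have "star u * u = b * b + c * c"
    by (simp add: su)
      (simp add: u_def distrib_left left_diff_distrib mult_scaleC_left mult_scaleC_right assms
        scaleC_diff_right scaleC_add_right)
  then have nu: "norm (b * b + c * c) = (norm u)\<^sup>2" using cstar_identity[of u] by simp
  have "u + star u = 2 *\<^sub>R b" by (simp add: su) (simp add: u_def scaleR_2)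
  then have "2 * norm b \<le> norm u + norm (star u)"
    using norm_triangle_ineq[of u "star u"] by simp
  then have "norm b \<le> norm u" by simp
  then show ?thesis
    using norm_square_self_adjoint[OF assms(1)] nu by (simp add: power_mono)
qed

text \<open>
  After scaling, \<open>d = b / norm b\<close> satisfies \<open>c\<^sup>2 + d\<^sup>2 = 1\<close> for a commuting self-adjoint \<open>c\<close>;
  then \<open>norm (1 - d\<^sup>2) = norm (c\<^sup>2) \<le> norm 1\<close>.
\<close>

lemma pos_square:
  fixes b :: "'a::unital_cstar_algebra"
  assumes "star b = b"
  shows "pos (b * b)"
proof (cases "b = 0")
  case False
  define n where "n = norm b"
  have n: "n > 0" using False by (simp add: n_def)
  define d where "d = b /\<^sub>R n"
  have d: "star d = d" "norm d = 1" using n by (simp_all add: d_def star_scaleR assms n_def)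
  have "norm (d * d) \<le> 1" using norm_square_self_adjoint[of d] d by simp
  then obtain c where c: "c * c = 1 - d * d" "star (d * d) = d * d \<Longrightarrow> star c = c"
    "\<And>w. w * (d * d) = (d * d) * w \<Longrightarrow> w * c = c * w"
    using sqrt_one_minus by metis
  have sc: "star c = c" using c(2) by (simp add: star_mult d)
  have "c * d = d * c" using c(3)[of d] by (simp add: mult.assoc)
  then have "norm (c * c) \<le> norm (c * c + d * d)"
    using norm_square_le_commuting[OF sc d(1)] by simp
  also have "\<dots> \<le> 1" by (simp add: c(1) norm_one_le)
  finally have "pos (d * d)"
    unfolding pos_def using c(1) by (auto simp: star_mult d intro!: exI[of _ 1])
  then have "pos ((n * n) *\<^sub>R (d * d))" using n by (intro pos_scaleR) auto
  moreover have "(n * n) *\<^sub>R (d * d) = b * b"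
  proof -
    have "b = n *\<^sub>R d" using n by (simp add: d_def)
    then show ?thesis by simp
  qed
  ultimately show ?thesis by simp
qed simp

text \<open>
  Square roots of \<open>a\<close> and \<open>- a\<close> commute, and their squares sum to zero.
\<close>

lemma pos_antisym: assumes "pos a" "pos (- a)" shows "a = 0"
proof -
  obtain b where b: "b * b = a" "pos b" "\<And>w. w * a = a * w \<Longrightarrow> w * b = b * w"
    using pos_sqrt[OF assms(1)] by metis
  obtain c where c: "c * c = - a" "pos c" "\<And>w. w * (- a) = (- a) * w \<Longrightarrow> w * c = c * w"
    using pos_sqrt[OF assms(2)] by metis
  have "b * a = a * b" using b(1) by (metis mult.assoc)
  then have "b * c = c * b" using c(3)[of b] by simp
  moreover have "star b = b" "star c = c" using b(2) c(2) by (simp_all add: pos_def)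
  ultimately have "norm (b * b) \<le> norm (b * b + c * c)"
    using norm_square_le_commuting by blast
  then show ?thesis using b(1) c(1) by simp
qed

lemma pos_sum_zero: assumes "pos a" "pos b" "a + b = 0" shows "a = 0"
proof -
  have "b = - a" using assms(3) by (simp add: add_eq_0_iff)
  then show ?thesis using assms pos_antisym[of a] by simp
qed

lemma norm_sub_pos:
  assumes "star (a::'a::unital_cstar_algebra) = a" "norm a \<le> t"
  shows "pos (t *\<^sub>R 1 - a)"
proof -
  have "t \<ge> 0" using assms(2) norm_ge_zero[of a] by linarith
  then show ?thesis
    using assms unfolding pos_def by (auto simp: star_diff star_scaleR intro!: exI[of _ t])
qed

text \<open>
  With \<open>t = norm b\<close>, the elements \<open>a\<close> and \<open>t - a\<close> are positive with commuting square roots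
  whose squares add up to the scalar \<open>t\<close>. Comparing \<open>a\<close> with a scalar instead of \<open>b\<close> is what
  supplies the commutation.
\<close>

lemma pos_norm_mono:
  assumes "pos a" "pos (b - a)" shows "norm a \<le> norm b"
proof -
  define t where "t = norm b"
  have "star b = b" using pos_add[OF assms] by (simp add: pos_def)
  then have "pos (t *\<^sub>R 1 - b)" by (simp add: norm_sub_pos t_def)
  from pos_add[OF this assms(2)] have p: "pos (t *\<^sub>R 1 - a)" by simp
  obtain c where c: "c * c = a" "pos c" "\<And>w. w * a = a * w \<Longrightarrow> w * c = c * w"
    using pos_sqrt[OF assms(1)] by metis
  obtain d where d: "d * d = t *\<^sub>R 1 - a" "pos d"
    "\<And>w. w * (t *\<^sub>R 1 - a) = (t *\<^sub>R 1 - a) * w \<Longrightarrow> w * d = d * w"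
    using pos_sqrt[OF p] by metis
  have "c * a = a * c" using c(1) by (metis mult.assoc)
  then have "c * d = d * c" using d(3)[of c] by (simp add: algebra_simps)
  moreover have "star c = c" "star d = d" using c(2) d(2) by (simp_all add: pos_def)
  ultimately have "norm (c * c) \<le> norm (c * c + d * d)"
    using norm_square_le_commuting by blast
  also have "c * c + d * d = t *\<^sub>R 1" using c(1) d(1) by simp
  also have "norm (t *\<^sub>R (1::'a)) \<le> t"
    using norm_one_le[where ?'a = 'a] by (simp add: t_def mult_left_le)
  finally show ?thesis using c(1) by (simp add: t_def)
qed

lemma self_adjoint_square_zero:
  assumes "star (x::'a::unital_cstar_algebra) = x" "x * x = 0"
  shows "x = 0"
proof -
  have "(norm x)\<^sup>2 = 0" using norm_square_self_adjoint[OF assms(1)] assms(2) by simp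
  then show ?thesis by simp
qed

text \<open>
  Twice this element is the sum of the squares of the self-adjoint \<open>w + star w\<close> and
  \<open>\<i> (w - star w)\<close>.
\<close>

lemma pos_star_mult_add: "pos (star w * w + w * star (w::'a::unital_cstar_algebra))"
proof -
  define h where "h = w + star w"
  define k where "k = scaleC \<i> (w - star w)"
  have sh: "star h = h" by (simp add: h_def star_add star_star)
  have sk: "star k = k"
    by (simp add: k_def star_scaleC star_diff star_star scaleC_minus_left scaleC_diff_right)
  have kk: "k * k = - ((w - star w) * (w - star w))"
    by (simp add: k_def mult_scaleC_left mult_scaleC_right scaleC_scaleC scaleC_minus_one)
  have "star w * w + w * star w = (1/2) *\<^sub>R (h * h + k * k)"
  proof -
    have "h * h + k * k = (star w * w + w * star w) + (star w * w + w * star w)"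
      by (simp add: kk) (simp add: h_def algebra_simps)
    then show ?thesis by (simp add: scaleR_2[symmetric])
  qed
  then show ?thesis by (simp add: pos_scaleR pos_add pos_square sh sk)
qed

text \<open>
  For \<open>a = star x * x\<close>, let \<open>m = \<bar>a\<bar>\<close>, so that \<open>e = m - a\<close> is twice the negative part; the
  claim is \<open>e = 0\<close>. From \<open>e * (m + a) = 0\<close> it follows that \<open>y = x * e\<close> satisfies
  \<open>star y * y = - s\<^sup>2\<close> for a self-adjoint \<open>s\<close>. For \<open>w = y * s\<close>, both \<open>star w * w\<close> and
  \<open>w * star w\<close> are then negatives of squares, while their sum is positive. So all these
  squares vanish, first \<open>s\<^sup>2\<close> and then \<open>e\<close>. Passing from \<open>y\<close> to \<open>w\<close> replaces the usual appeal
  to the equality of the nonzero spectra of \<open>star y * y\<close> and \<open>y * star y\<close>.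
\<close>

theorem pos_star_mult_self: "pos (star x * (x::'a::unital_cstar_algebra))"
proof -
  define a where "a = star x * x"
  have sa: "star a = a" by (simp add: a_def star_mult star_star)
  obtain m where m: "m * m = a * a" "pos m" "\<And>w. w * (a * a) = (a * a) * w \<Longrightarrow> w * m = m * w"
    using pos_sqrt[OF pos_square[OF sa]] by metis
  have am: "a * m = m * a" using m(3)[of a] by (simp add: mult.assoc)
  obtain r where r: "r * r = m" "pos r" "\<And>w. w * m = m * w \<Longrightarrow> w * r = r * w"
    using pos_sqrt[OF m(2)] by metis
  define e where "e = m - a"
  have se: "star e = e" using m(2) sa by (simp add: e_def pos_def star_diff)
  have sr: "star r = r" using r(2) by (simp add: pos_def)
  have em: "e * m = m * e" using am by (simp add: e_def algebra_simps)
  have er: "e * r = r * e" using r(3)[OF em] .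
  \<comment> \<open>Here \<open>s\<^sup>2 = e\<^sup>2 * m\<close>; extracting the root of \<open>m\<close> avoids having to prove \<open>e\<close> positive.\<close>
  define s where "s = e * r"
  have ss: "star s = s" using se sr er by (simp add: s_def star_mult)
  have e0: "e * (m + a) = 0" using m(1) am by (simp add: e_def algebra_simps)
  have ea: "e * a = a * e" using am by (simp add: e_def algebra_simps)
  have ea2: "e * a = - (e * m)" using e0 by (simp add: distrib_left eq_neg_iff_add_eq_0 add.commute)
  have ss2: "s * s = e * (m * e)"
    unfolding s_def r(1)[symmetric] using er by (metis mult.assoc)
  define y where "y = x * e"
  have yy: "star y * y = - (s * s)"
  proof -
    have "star y * y = e * a * e" by (simp add: y_def star_mult se a_def mult.assoc)
    also have "\<dots> = - (s * s)" by (simp add: ea2 ss2 mult.assoc)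
    finally show ?thesis .
  qed
  define w where "w = y * s"
  have ww: "star w * w = - ((s * s) * (s * s))"
  proof -
    have "star w * w = s * (star y * y) * s" by (simp add: w_def star_mult ss mult.assoc)
    then show ?thesis by (simp add: yy mult.assoc)
  qed
  have ww': "w * star w = - ((y * star y) * (y * star y))"
  proof -
    have "w * star w = y * (s * s) * star y" by (simp add: w_def star_mult ss mult.assoc)
    also have "s * s = - (star y * y)" by (simp add: yy)
    finally show ?thesis by (simp add: mult.assoc)
  qed
  have sss: "star (s * s) = s * s" by (simp add: star_mult ss)
  have p1: "pos ((s * s) * (s * s))" by (rule pos_square[OF sss])
  have p2: "pos ((y * star y) * (y * star y))" by (rule pos_square) (simp add: star_mult star_star)
  have "pos (- ((s * s) * (s * s) + (y * star y) * (y * star y)))"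
    using pos_star_mult_add[of w] by (simp add: ww ww')
  then have "(s * s) * (s * s) + (y * star y) * (y * star y) = 0"
    using pos_antisym pos_add[OF p1 p2] by blast
  then have "(s * s) * (s * s) = 0" using pos_sum_zero[OF p1 p2] by blast
  then have s0: "s * s = 0" using self_adjoint_square_zero sss by blast
  have "e * e = 0"
  proof -
    have "e * (e * e) = s * s + s * s"
    proof -
      have "e * (e * e) = e * (m * e) - (e * a) * e"
        by (simp add: e_def algebra_simps)
      then show ?thesis by (simp add: ea2 ss2 mult.assoc)
    qed
    then have "(e * e) * (e * e) = 0" by (simp add: s0 mult.assoc) 
    then show ?thesis using self_adjoint_square_zero[of "e * e"] by (simp add: star_mult se)
  qed
  then have "e = 0" using self_adjoint_square_zero se by blast
  then show ?thesis using m(2) by (simp add: e_def a_def)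
qed

section \<open>The standard module as a Banach space\<close>

lemma pos_conjugate:
  assumes "pos a" shows "pos (star c * a * c)"
proof -
  obtain b where b: "b * b = a" "pos b" using pos_sqrt[OF assms] by metis
  have "star b = b" using b(2) by (simp add: pos_def)
  then have "star c * a * c = star (b * c) * (b * c)"
    by (simp add: b(1)[symmetric] star_mult mult.assoc)
  then show ?thesis by (simp add: pos_star_mult_self)
qed

text \<open>
  The Hilbert module norm of the restriction of \<open>x\<close> to a finite index set. All convergence
  questions about \<open>H\<^sub>\<A>\<close> are reduced to estimates for it on finite sets, uniform in the set.
\<close>

definition seg_norm :: "nat set \<Rightarrow> (nat \<Rightarrow> 'a::unital_cstar_algebra) \<Rightarrow> real" where
  "seg_norm F x = sqrt (norm (\<Sum>i\<in>F. star (x i) * x i))"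

lemma seg_norm_nonneg [simp]: "seg_norm F x \<ge> 0"
  by (simp add: seg_norm_def)

lemma seg_norm_square: "(seg_norm F x)\<^sup>2 = norm (\<Sum>i\<in>F. star (x i) * x i)"
  by (simp add: seg_norm_def)

lemma pos_gram: "pos (\<Sum>i\<in>F. star (x i) * x i)"
  by (intro pos_sum pos_star_mult_self)

text \<open>
  Expand the positive element \<open>\<langle>x - y c, x - y c\<rangle>\<close> for \<open>c = \<langle>y, x\<rangle> / t\<close>. Since
  \<open>star c * \<langle>y, y\<rangle> * c \<le> t * star c * c\<close> for \<open>t > norm \<langle>y, y\<rangle>\<close>, this gives
  \<open>\<langle>x, y\<rangle> \<langle>y, x\<rangle> \<le> t \<langle>x, x\<rangle>\<close>, and the norm is monotone on positive elements. Taking \<open>t\<close>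
  strictly larger avoids division by zero; then \<open>t\<close> tends to \<open>norm \<langle>y, y\<rangle>\<close>.
\<close>

lemma cauchy_schwarz_finite:
  fixes x y :: "nat \<Rightarrow> 'a::unital_cstar_algebra"
  shows "norm (\<Sum>i\<in>F. star (x i) * y i) \<le> seg_norm F x * seg_norm F y"
proof -
  define X where "X = (\<Sum>i\<in>F. star (x i) * x i)"
  define Y where "Y = (\<Sum>i\<in>F. star (y i) * y i)"
  define S where "S = (\<Sum>i\<in>F. star (x i) * y i)"
  have sS: "star S = (\<Sum>i\<in>F. star (y i) * x i)"
    by (simp add: S_def star_sum star_mult star_star)
  have bound: "(norm S)\<^sup>2 \<le> t * norm X" if t: "t > norm Y" for t
  proof -
    have t0: "t > 0" using t norm_ge_zero[of Y] by linarith
    define c where "c = star S /\<^sub>R t"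
    have sc: "star c = S /\<^sub>R t" by (simp add: c_def star_scaleR star_star)
    have "(\<Sum>i\<in>F. star (x i - y i * c) * (x i - y i * c))
        = (\<Sum>i\<in>F. star (x i) * x i - star (x i) * y i * c - star c * (star (y i) * x i)
            + star c * (star (y i) * y i) * c)"
      by (rule sum.cong) (simp_all add: star_diff star_mult algebra_simps)
    also have "\<dots> = X - S * c - star c * star S + star c * Y * c"
      by (simp add: sum.distrib sum_subtractf sS)
        (simp add: X_def Y_def S_def sum_distrib_left sum_distrib_right)
    finally have p1: "pos (X - S * c - star c * star S + star c * Y * c)"
      using pos_gram[of "\<lambda>i. x i - y i * c" F] by simp
    have "pos (t *\<^sub>R 1 - Y)"
      using norm_sub_pos[of Y t] t pos_gram[of y F] by (simp add: pos_def Y_def)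
    then have p2: "pos (star c * (t *\<^sub>R 1 - Y) * c)" by (rule pos_conjugate)
    have eq: "X - S * c - star c * star S + star c * Y * c + star c * (t *\<^sub>R 1 - Y) * c
        = X - (1 / t) *\<^sub>R (S * star S)"
      using t0 by (simp add: sc) (simp add: c_def algebra_simps divide_inverse)
    have p3: "pos (X - (1 / t) *\<^sub>R (S * star S))" using pos_add[OF p1 p2] by (simp only: eq)
    have "pos (S * star S)" using pos_star_mult_self[of "star S"] by (simp add: star_star)
    then have "pos ((1 / t) *\<^sub>R (S * star S))" using t0 by (simp add: pos_scaleR)
    from pos_norm_mono[OF this p3] have "norm (S * star S) / t \<le> norm X" using t0 by simp
    moreover have "norm (S * star S) = (norm S)\<^sup>2"
      using cstar_identity[of "star S"] by (simp add: star_star)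
    ultimately show ?thesis using t0 by (simp add: field_simps)
  qed
  have "(norm S)\<^sup>2 \<le> norm Y * norm X"
  proof (rule field_le_epsilon)
    fix e :: real assume e: "e > 0"
    define d where "d = e / (norm X + 1)"
    have n1: "norm X + 1 > 0" using norm_ge_zero[of X] by linarith
    have d: "d > 0" using e n1 by (simp add: d_def)
    have "d * norm X \<le> d * (norm X + 1)" using d by simp
    also have "\<dots> = e" using n1 by (simp add: d_def)
    finally show "(norm S)\<^sup>2 \<le> norm Y * norm X + e"
      using bound[of "norm Y + d"] d by (simp add: algebra_simps)
  qed
  also have "\<dots> = (seg_norm F x * seg_norm F y)\<^sup>2"
    by (simp add: power_mult_distrib seg_norm_square X_def Y_def)
  finally show ?thesis
    unfolding S_def by (rule power2_le_imp_le) simp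
qed

lemma seg_norm_triangle: "seg_norm F (x + y) \<le> seg_norm F x + seg_norm F y"
proof (rule power2_le_imp_le)
  let ?g = "\<lambda>u v. \<Sum>i\<in>F. star (u i) * v i"
  have "?g (x + y) (x + y) = ?g x x + ?g x y + ?g y x + ?g y y"
    by (simp add: star_add algebra_simps sum.distrib)
  then have "(seg_norm F (x + y))\<^sup>2 = norm (?g x x + ?g x y + ?g y x + ?g y y)"
    by (simp add: seg_norm_square)
  also have "\<dots> \<le> norm (?g x x) + norm (?g x y) + norm (?g y x) + norm (?g y y)"
    by (meson norm_triangle_le add_mono order_refl)
  also have "\<dots> \<le> (seg_norm F x + seg_norm F y)\<^sup>2"
    using cauchy_schwarz_finite[of x y F] cauchy_schwarz_finite[of y x F]
    by (simp add: power2_sum seg_norm_square algebra_simps)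
  finally show "(seg_norm F (x + y))\<^sup>2 \<le> (seg_norm F x + seg_norm F y)\<^sup>2" .
qed simp

lemma seg_norm_scaleR: "seg_norm F (\<lambda>i. r *\<^sub>R x i) = \<bar>r\<bar> * seg_norm F x"
proof -
  have "(\<Sum>i\<in>F. star (r *\<^sub>R x i) * (r *\<^sub>R x i)) = (r * r) *\<^sub>R (\<Sum>i\<in>F. star (x i) * x i)"
    by (simp add: star_scaleR scaleR_sum_right)
  then show ?thesis by (simp add: seg_norm_def real_sqrt_mult)
qed

lemma seg_norm_uminus: "seg_norm F (- x) = seg_norm F x"
  by (simp add: seg_norm_def star_minus)

lemma seg_norm_minus_commute: "seg_norm F (x - y) = seg_norm F (y - x)"
  using seg_norm_uminus[of F "x - y"] by simp

lemma seg_norm_mono: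
  assumes "F \<subseteq> G" "finite G" shows "seg_norm F x \<le> seg_norm G x"
proof -
  have "(\<Sum>i\<in>G. star (x i) * x i) - (\<Sum>i\<in>F. star (x i) * x i) = (\<Sum>i\<in>G - F. star (x i) * x i)"
    using assms by (simp add: sum_diff)
  then have "norm (\<Sum>i\<in>F. star (x i) * x i) \<le> norm (\<Sum>i\<in>G. star (x i) * x i)"
    using pos_norm_mono[OF pos_gram, of _ x F] pos_gram[of x "G - F"] by simp
  then show ?thesis by (simp add: seg_norm_def)
qed

lemma seg_norm_singleton: "seg_norm {k} x = norm (x k)"
  by (simp add: seg_norm_def cstar_identity)

text \<open>
  Cauchy's criterion for the defining series. In this form, closure of \<open>H\<^sub>\<A>\<close> under addition
  and limits only needs the triangle inequality for finite segments.
\<close>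

lemma HA_iff_seg_norm:
  "x \<in> HA \<longleftrightarrow> (\<forall>e>0. \<exists>N. \<forall>m\<ge>N. \<forall>n. seg_norm {m..<n} x < e)"
proof
  assume x: "x \<in> HA"
  show "\<forall>e>0. \<exists>N. \<forall>m\<ge>N. \<forall>n. seg_norm {m..<n} x < e"
  proof (intro allI impI)
    fix e :: real assume "e > 0"
    then have e: "e\<^sup>2 > 0" by simp
    have "summable (\<lambda>i. star (x i) * x i)" using x by (simp add: HA_def)
    then obtain N where N: "\<forall>m\<ge>N. \<forall>n. norm (\<Sum>i\<in>{m..<n}. star (x i) * x i) < e\<^sup>2"
      using e unfolding summable_Cauchy by blast
    have "seg_norm {m..<n} x < e" if "m \<ge> N" for m n
      using N that \<open>e > 0\<close> by (auto simp: seg_norm_def intro!: real_less_lsqrt)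
    then show "\<exists>N. \<forall>m\<ge>N. \<forall>n. seg_norm {m..<n} x < e" by blast
  qed
next
  assume a: "\<forall>e>0. \<exists>N. \<forall>m\<ge>N. \<forall>n. seg_norm {m..<n} x < e"
  show "x \<in> HA" unfolding HA_def summable_Cauchy mem_Collect_eq
  proof (intro allI impI)
    fix e :: real assume e: "e > 0"
    then obtain N where N: "\<forall>m\<ge>N. \<forall>n. seg_norm {m..<n} x < sqrt e"
      using a real_sqrt_gt_zero by blast
    then show "\<exists>N. \<forall>m\<ge>N. \<forall>n. norm (\<Sum>i\<in>{m..<n}. star (x i) * x i) < e"
      by (auto simp: seg_norm_def)
  qed
qed

lemma HA_zero: "0 \<in> HA"
  by (simp add: HA_def)

lemma HA_add: assumes "x \<in> HA" "y \<in> HA" shows "x + y \<in> HA"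
  unfolding HA_iff_seg_norm
proof (intro allI impI)
  fix e :: real assume "e > 0"
  then have e: "e / 2 > 0" by simp
  obtain N1 where N1: "\<forall>m\<ge>N1. \<forall>n. seg_norm {m..<n} x < e / 2"
    using assms(1) e unfolding HA_iff_seg_norm by blast
  obtain N2 where N2: "\<forall>m\<ge>N2. \<forall>n. seg_norm {m..<n} y < e / 2"
    using assms(2) e unfolding HA_iff_seg_norm by blast
  have "seg_norm {m..<n} (x + y) < e" if "m \<ge> max N1 N2" for m n
  proof -
    have "seg_norm {m..<n} x < e / 2" "seg_norm {m..<n} y < e / 2" using N1 N2 that by auto
    then show ?thesis using seg_norm_triangle[of "{m..<n}" x y] by linarith
  qed
  then show "\<exists>N. \<forall>m\<ge>N. \<forall>n. seg_norm {m..<n} (x + y) < e" by blast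
qed

lemma HA_ract: assumes "x \<in> HA" shows "ract x a \<in> HA"
proof -
  have "summable (\<lambda>n. star a * (star (x n) * x n) * a)"
    using assms by (intro summable_mult summable_mult2) (simp add: HA_def)
  then show ?thesis by (simp add: HA_def ract_def star_mult mult.assoc)
qed

lemma ract_scaleR_one: "ract x (r *\<^sub>R 1) = (\<lambda>i. r *\<^sub>R x i)"
  by (simp add: ract_def)

lemma HA_scaleR: "x \<in> HA \<Longrightarrow> (\<lambda>i. r *\<^sub>R x i) \<in> HA"
  using HA_ract[of x "r *\<^sub>R 1"] by (simp add: ract_scaleR_one)

lemma HA_uminus: "x \<in> HA \<Longrightarrow> - x \<in> HA"
  by (simp add: HA_def star_minus)

lemma HA_diff: assumes "x \<in> HA" "y \<in> HA" shows "x - y \<in> HA"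
  using HA_add[OF assms(1) HA_uminus[OF assms(2)]] by simp

lemma seg_norm_tendsto:
  assumes "x \<in> HA" shows "(\<lambda>n. seg_norm {..<n} x) \<longlonglongrightarrow> norm_HA x"
proof -
  have "summable (\<lambda>i. star (x i) * x i)" using assms by (simp add: HA_def)
  from summable_LIMSEQ[OF this] show ?thesis
    unfolding seg_norm_def norm_HA_def inner_HA_def by (intro tendsto_intros)
qed

lemma seg_norm_le_norm_HA:
  assumes "x \<in> HA" "finite F" shows "seg_norm F x \<le> norm_HA x"
proof (rule LIMSEQ_le_const[OF seg_norm_tendsto[OF assms(1)]])
  obtain k where k: "\<forall>i\<in>F. i < k" using finite_nat_set_iff_bounded assms(2) by blast
  then show "\<exists>N. \<forall>n\<ge>N. seg_norm F x \<le> seg_norm {..<n} x"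
    by (intro exI[of _ k] allI impI seg_norm_mono) auto
qed

lemma norm_HA_leI:
  assumes "x \<in> HA" "\<And>n. seg_norm {..<n} x \<le> c" shows "norm_HA x \<le> c"
  by (rule LIMSEQ_le_const2[OF seg_norm_tendsto[OF assms(1)]]) (use assms(2) in auto)

lemma norm_HA_triangle:
  assumes "x \<in> HA" "y \<in> HA" shows "norm_HA (x + y) \<le> norm_HA x + norm_HA y"
proof (rule norm_HA_leI[OF HA_add[OF assms]])
  fix n show "seg_norm {..<n} (x + y) \<le> norm_HA x + norm_HA y"
    using seg_norm_triangle[of "{..<n}" x y] seg_norm_le_norm_HA[OF assms(1), of "{..<n}"]
      seg_norm_le_norm_HA[OF assms(2), of "{..<n}"] by simp
qed

lemma norm_HA_scaleR:
  assumes "x \<in> HA" shows "norm_HA (\<lambda>i. r *\<^sub>R x i) = \<bar>r\<bar> * norm_HA x"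
proof (rule LIMSEQ_unique[OF seg_norm_tendsto[OF HA_scaleR[OF assms]]])
  show "(\<lambda>n. seg_norm {..<n} (\<lambda>i. r *\<^sub>R x i)) \<longlonglongrightarrow> \<bar>r\<bar> * norm_HA x"
    unfolding seg_norm_scaleR by (intro tendsto_intros seg_norm_tendsto assms)
qed

lemma norm_HA_eq_0: assumes "x \<in> HA" "norm_HA x = 0" shows "x = 0"
proof
  fix k show "x k = 0 k"
    using seg_norm_le_norm_HA[OF assms(1), of "{k}"] assms(2) by (simp add: seg_norm_singleton)
qed

lemma norm_HA_zero [simp]: "norm_HA 0 = 0"
  by (simp add: norm_HA_def inner_HA_def)

text \<open>
  Making \<open>H\<^sub>\<A>\<close> a type of class \<open>banach\<close> gives access to the type class based theory of Banach
  spaces.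
\<close>

typedef (overloaded) 'a hmod = "HA :: (nat \<Rightarrow> 'a::unital_cstar_algebra) set"
  using HA_zero by blast

lemmas Rep_HA [simp] = Rep_hmod
lemmas Abs_HA [simp] = Abs_hmod_inverse
lemmas Rep_Abs [simp] = Rep_hmod_inverse

instantiation hmod :: (unital_cstar_algebra) real_normed_vector
begin

definition zero_hmod :: "'a hmod"
  where "zero_hmod = Abs_hmod 0"
definition plus_hmod :: "'a hmod \<Rightarrow> 'a hmod \<Rightarrow> 'a hmod"
  where "plus_hmod u v = Abs_hmod (Rep_hmod u + Rep_hmod v)"
definition minus_hmod :: "'a hmod \<Rightarrow> 'a hmod \<Rightarrow> 'a hmod"
  where "minus_hmod u v = Abs_hmod (Rep_hmod u - Rep_hmod v)"
definition uminus_hmod :: "'a hmod \<Rightarrow> 'a hmod"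
  where "uminus_hmod u = Abs_hmod (- Rep_hmod u)"
definition scaleR_hmod :: "real \<Rightarrow> 'a hmod \<Rightarrow> 'a hmod"
  where "scaleR_hmod r u = Abs_hmod (\<lambda>i. r *\<^sub>R Rep_hmod u i)"
definition norm_hmod :: "'a hmod \<Rightarrow> real"
  where "norm_hmod u = norm_HA (Rep_hmod u)"
definition sgn_hmod :: "'a hmod \<Rightarrow> 'a hmod"
  where "sgn_hmod u = scaleR (inverse (norm u)) u"
definition dist_hmod :: "'a hmod \<Rightarrow> 'a hmod \<Rightarrow> real"
  where "dist_hmod u v = norm (u - v)"
definition uniformity_hmod :: "('a hmod \<times> 'a hmod) filter"
  where "uniformity_hmod = (INF e\<in>{0<..}. principal {(x, y). dist x y < e})"
definition open_hmod :: "'a hmod set \<Rightarrow> bool"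
  where "open_hmod U = (\<forall>x\<in>U. \<forall>\<^sub>F (x', y) in uniformity. x' = x \<longrightarrow> y \<in> U)"

lemma Rep_zero: "Rep_hmod (0 :: 'a hmod) = 0"
  by (simp add: zero_hmod_def HA_zero)

lemma Rep_add: "Rep_hmod (u + v :: 'a hmod) = Rep_hmod u + Rep_hmod v"
  by (simp add: plus_hmod_def HA_add)

lemma Rep_diff: "Rep_hmod (u - v :: 'a hmod) = Rep_hmod u - Rep_hmod v"
  by (simp add: minus_hmod_def HA_diff)

lemma Rep_uminus: "Rep_hmod (- u :: 'a hmod) = - Rep_hmod u"
  by (simp add: uminus_hmod_def HA_uminus)

lemma Rep_scaleR: "Rep_hmod (r *\<^sub>R u :: 'a hmod) = (\<lambda>i. r *\<^sub>R Rep_hmod u i)"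
  by (simp add: scaleR_hmod_def HA_scaleR)

lemmas Rep_simps = Rep_zero Rep_add Rep_diff Rep_uminus Rep_scaleR

instance
proof
  fix u v w :: "'a hmod" and r s :: real
  show "u + v + w = u + (v + w)" "u + v = v + u" "0 + u = u" "- u + u = 0" "u - v = u + - v"
    by (simp_all add: Rep_hmod_inject[symmetric] Rep_simps add.assoc add.commute)
  show "r *\<^sub>R (u + v) = r *\<^sub>R u + r *\<^sub>R v" "(r + s) *\<^sub>R u = r *\<^sub>R u + s *\<^sub>R u"
    "r *\<^sub>R s *\<^sub>R u = (r * s) *\<^sub>R u" "1 *\<^sub>R u = u"
    by (simp_all add: Rep_hmod_inject[symmetric] Rep_simps fun_eq_iff scaleR_add_right scaleR_add_left)
  show "dist u v = norm (u - v)" by (rule dist_hmod_def)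
  show "sgn u = scaleR (inverse (norm u)) u" by (rule sgn_hmod_def)
  show "uniformity = (INF e\<in>{0<..}. principal {(x, y :: 'a hmod). dist x y < e})"
    by (rule uniformity_hmod_def)
  show "open U = (\<forall>x\<in>U. \<forall>\<^sub>F (x', y) in uniformity. x' = x \<longrightarrow> y \<in> U)" for U :: "'a hmod set"
    by (rule open_hmod_def)
  show "norm u = 0 \<longleftrightarrow> u = 0"
    using norm_HA_eq_0[of "Rep_hmod u"]
    by (auto simp: norm_hmod_def Rep_hmod_inject[symmetric] Rep_simps)
  show "norm (u + v) \<le> norm u + norm v"
    by (simp add: norm_hmod_def Rep_simps norm_HA_triangle)
  show "norm (r *\<^sub>R u) = \<bar>r\<bar> * norm u"
    by (simp add: norm_hmod_def Rep_simps norm_HA_scaleR)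
qed

end

lemma norm_coordinate_le: "norm (Rep_hmod u k) \<le> norm u"
  using seg_norm_le_norm_HA[of "Rep_hmod u" "{k}"] by (simp add: seg_norm_singleton norm_hmod_def)

text \<open>
  A Cauchy sequence converges in each coordinate, and the segment norms of its distance to the
  coordinatewise limit are small uniformly in the segment. That bound puts the limit in \<open>H\<^sub>\<A>\<close>
  and gives norm convergence.
\<close>

instance hmod :: (unital_cstar_algebra) banach
proof
  fix X :: "nat \<Rightarrow> 'a hmod" assume X: "Cauchy X"
  define x where "x i = lim (\<lambda>k. Rep_hmod (X k) i)" for i
  have lim: "(\<lambda>k. Rep_hmod (X k) i) \<longlonglongrightarrow> x i" for i
  proof -
    have "Cauchy (\<lambda>k. Rep_hmod (X k) i)"
    proof (rule metric_CauchyI)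
      fix e :: real assume "e > 0"
      then obtain M where M: "\<forall>m\<ge>M. \<forall>n\<ge>M. dist (X m) (X n) < e"
        using X unfolding Cauchy_def by blast
      have "dist (Rep_hmod (X m) i) (Rep_hmod (X n) i) \<le> dist (X m) (X n)" for m n
        using norm_coordinate_le[of "X m - X n" i] by (simp add: dist_norm Rep_simps)
      then show "\<exists>M. \<forall>m\<ge>M. \<forall>n\<ge>M. dist (Rep_hmod (X m) i) (Rep_hmod (X n) i) < e"
        using M by (meson le_less_trans)
    qed
    then show ?thesis unfolding x_def using Cauchy_convergent_iff convergent_LIMSEQ_iff by blast
  qed
  have close: "\<exists>J. \<forall>j\<ge>J. \<forall>F. finite F \<longrightarrow> seg_norm F (Rep_hmod (X j) - x) \<le> e" if e: "e > 0" for e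
  proof -
    obtain J where J: "\<forall>m\<ge>J. \<forall>n\<ge>J. dist (X m) (X n) < e"
      using X e unfolding Cauchy_def by blast
    have "seg_norm F (Rep_hmod (X j) - x) \<le> e" if j: "j \<ge> J" and F: "finite F" for j F
    proof (rule LIMSEQ_le_const2)
      show "(\<lambda>k. seg_norm F (Rep_hmod (X j) - Rep_hmod (X k))) \<longlonglongrightarrow> seg_norm F (Rep_hmod (X j) - x)"
        unfolding seg_norm_def minus_apply
        by (intro tendsto_intros lim bounded_linear.tendsto[OF bounded_linear_star])
      have "seg_norm F (Rep_hmod (X j) - Rep_hmod (X k)) \<le> e" if "k \<ge> J" for k
      proof -
        have "seg_norm F (Rep_hmod (X j) - Rep_hmod (X k)) \<le> dist (X j) (X k)"
          using seg_norm_le_norm_HA[OF Rep_HA[of "X j - X k"] F]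
          by (simp add: dist_norm norm_hmod_def Rep_simps)
        also have "dist (X j) (X k) < e" using J j that by blast
        finally show ?thesis by simp
      qed
      then show "\<exists>N. \<forall>k\<ge>N. seg_norm F (Rep_hmod (X j) - Rep_hmod (X k)) \<le> e" by blast
    qed
    then show ?thesis by blast
  qed
  have x: "x \<in> HA" unfolding HA_iff_seg_norm
  proof (intro allI impI)
    fix e :: real assume "e > 0"
    then have e: "e / 2 > 0" by simp
    obtain j where j: "\<And>F. finite F \<Longrightarrow> seg_norm F (Rep_hmod (X j) - x) \<le> e / 2"
      using close[OF e] by blast
    obtain N where N: "\<forall>m\<ge>N. \<forall>n. seg_norm {m..<n} (Rep_hmod (X j)) < e / 2"
      using Rep_HA[of "X j"] e unfolding HA_iff_seg_norm by blast
    have "seg_norm {m..<n} x < e" if "m \<ge> N" for m n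
    proof -
      have "seg_norm {m..<n} (Rep_hmod (X j)) < e / 2" using N that by blast
      moreover have "seg_norm {m..<n} (x - Rep_hmod (X j)) \<le> e / 2"
        using j[of "{m..<n}"] by (simp add: seg_norm_minus_commute)
      ultimately show ?thesis
        using seg_norm_triangle[of "{m..<n}" "Rep_hmod (X j)" "x - Rep_hmod (X j)"] by simp
    qed
    then show "\<exists>N. \<forall>m\<ge>N. \<forall>n. seg_norm {m..<n} x < e" by blast
  qed
  have "X \<longlonglongrightarrow> Abs_hmod x"
  proof (rule metric_LIMSEQ_I)
    fix e :: real assume "e > 0"
    then have e: "e / 2 > 0" by simp
    obtain J where J: "\<forall>j\<ge>J. \<forall>F. finite F \<longrightarrow> seg_norm F (Rep_hmod (X j) - x) \<le> e / 2"
      using close[OF e] by blast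
    have "dist (X j) (Abs_hmod x) < e" if "j \<ge> J" for j
    proof -
      have "norm_HA (Rep_hmod (X j) - x) \<le> e / 2"
        using J that x by (intro norm_HA_leI HA_diff) auto
      then show ?thesis using \<open>e > 0\<close> x by (simp add: dist_norm norm_hmod_def Rep_simps)
    qed
    then show "\<exists>J. \<forall>j\<ge>J. dist (X j) (Abs_hmod x) < e" by blast
  qed
  then show "convergent X" by (rule convergentI)
qed

section \<open>Complemented subspaces of Banach spaces\<close>

text \<open>
  An instance of the open mapping theorem, for the addition map from \<open>M \<times> N\<close>. By Baire, the
  closure of some set \<open>E k\<close> of vectors whose \<open>M\<close>-component has norm at most \<open>k\<close> has interior
  points. Differences of elements of \<open>E k\<close> approximate every vector of a ball around zero;
  rescaling shows that each \<open>v\<close> can be approximated up to \<open>norm v / 2\<close> with control of the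
  \<open>M\<close>-component. Iterating this and summing the geometric series of components reaches \<open>v\<close>
  itself.
\<close>

lemma complement_bounded:
  fixes M N :: "'b::banach set"
  assumes M: "subspace M" "closed M" and N: "subspace N" "closed N"
    and inter: "M \<inter> N = {0}" and sum: "\<And>v. \<exists>m\<in>M. v - m \<in> N"
  obtains C where "C > 0" "\<And>v m. m \<in> M \<Longrightarrow> v - m \<in> N \<Longrightarrow> norm m \<le> C * norm v"
proof -
  define E where "E k = {v. \<exists>m\<in>M. v - m \<in> N \<and> norm m \<le> real k}" for k :: nat
  have "\<exists>k. interior (closure (E k)) \<noteq> {}"
  proof (rule ccontr)
    assume "\<not> ?thesis"
    then have "Met_TC.mtopology interior_of \<Union>(range (\<lambda>k. closure (E k))) = {}"
      by (intro Met_TC.metric_Baire_category_alt) (auto simp: complete_UNIV)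
    moreover have "\<Union>(range (\<lambda>k. closure (E k))) = UNIV"
    proof -
      have "v \<in> (\<Union>k. closure (E k))" for v
      proof -
        obtain m where m: "m \<in> M" "v - m \<in> N" using sum by blast
        obtain k where "norm m \<le> real k" using real_arch_simple by blast
        then have "v \<in> E k" using m by (auto simp: E_def)
        then show ?thesis using closure_subset by blast
      qed
      then show ?thesis by blast
    qed
    ultimately show False by simp
  qed
  then obtain k x0 where x0: "x0 \<in> interior (closure (E k))" by blast
  then obtain r where r: "r > 0" "ball x0 r \<subseteq> closure (E k)" by (auto simp: mem_interior)
  have approx: "\<exists>m\<in>M. \<exists>n\<in>N. norm (v - (m + n)) < e \<and> norm m \<le> 2 * real k"
    if v: "norm v < r" and e: "e > 0" for v e
  proof -
    have e2: "e / 2 > 0" using e by simp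
    have "x0 + v \<in> closure (E k)" "x0 \<in> closure (E k)"
      using r v by (auto simp: dist_norm subset_eq)
    then obtain a b where a: "a \<in> E k" "dist a (x0 + v) < e / 2" and b: "b \<in> E k" "dist b x0 < e / 2"
      using e2 by (meson closure_approachable)
    obtain ma where ma: "ma \<in> M" "a - ma \<in> N" "norm ma \<le> real k" using a by (auto simp: E_def)
    obtain mb where mb: "mb \<in> M" "b - mb \<in> N" "norm mb \<le> real k" using b by (auto simp: E_def)
    have "v - ((ma - mb) + ((a - ma) - (b - mb))) = (b - x0) - (a - (x0 + v))"
      by (simp add: algebra_simps)
    also have "norm \<dots> < e"
      using norm_triangle_ineq4[of "b - x0" "a - (x0 + v)"] a(2) b(2)
      by (simp add: dist_norm)
    finally have "norm (v - ((ma - mb) + ((a - ma) - (b - mb)))) < e" .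
    moreover have "norm (ma - mb) \<le> 2 * real k"
      using norm_triangle_ineq4[of ma mb] ma mb by linarith
    ultimately show ?thesis
      using ma mb M(1) N(1) by (meson subspace_diff)
  qed
  define K where "K = 4 * real k / r"
  have K: "K \<ge> 0" using r by (simp add: K_def)
  have "\<forall>v. \<exists>p. fst p \<in> M \<and> snd p \<in> N \<and> norm (v - (fst p + snd p)) \<le> norm v / 2 \<and> norm (fst p) \<le> K * norm v"
  proof
    fix v
    show "\<exists>p. fst p \<in> M \<and> snd p \<in> N \<and> norm (v - (fst p + snd p)) \<le> norm v / 2 \<and> norm (fst p) \<le> K * norm v"
    proof (cases "v = 0")
      case True
      then show ?thesis using M(1) N(1) by (intro exI[of _ "(0, 0)"]) (simp add: subspace_0)
    next
      case False
      define s where "s = r / (2 * norm v)"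
      have s: "s > 0" using r False by (simp add: s_def)
      have "norm (s *\<^sub>R v) < r" using r False by (simp add: s_def)
      then obtain m n where mn: "m \<in> M" "n \<in> N" "norm (s *\<^sub>R v - (m + n)) < r / 4" "norm m \<le> 2 * real k"
        using approx[of "s *\<^sub>R v" "r / 4"] r by auto
      have "v - (m /\<^sub>R s + n /\<^sub>R s) = (s *\<^sub>R v - (m + n)) /\<^sub>R s"
        using s by (simp add: algebra_simps)
      then have "norm (v - (m /\<^sub>R s + n /\<^sub>R s)) = norm (s *\<^sub>R v - (m + n)) / s"
        using s by (simp add: divide_inverse mult.commute)
      also have "\<dots> \<le> (r / 4) / s" by (rule divide_right_mono) (use mn(3) s in auto)
      also have "\<dots> = norm v / 2" using r False by (simp add: s_def)
      finally have 1: "norm (v - (m /\<^sub>R s + n /\<^sub>R s)) \<le> norm v / 2" .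
      have "norm (m /\<^sub>R s) = norm m / s" using s by (simp add: divide_inverse mult.commute)
      also have "\<dots> \<le> 2 * real k / s" by (rule divide_right_mono) (use mn(4) s in auto)
      also have "\<dots> = K * norm v" using r False by (simp add: s_def K_def)
      finally have 2: "norm (m /\<^sub>R s) \<le> K * norm v" .
      show ?thesis
        using 1 2 mn M(1) N(1) by (intro exI[of _ "(m /\<^sub>R s, n /\<^sub>R s)"]) (simp add: subspace_scale)
    qed
  qed
  then obtain p where p: "\<And>v. fst (p v) \<in> M" "\<And>v. snd (p v) \<in> N"
    "\<And>v. norm (v - (fst (p v) + snd (p v))) \<le> norm v / 2" "\<And>v. norm (fst (p v)) \<le> K * norm v"
    by metis
  have main: "\<exists>m\<in>M. v - m \<in> N \<and> norm m \<le> 2 * K * norm v" for v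
  proof -
    \<comment> \<open>The successive errors, at least halved in each step.\<close>
    define w where "w = rec_nat v (\<lambda>_ u. u - (fst (p u) + snd (p u)))"
    have w0: "w 0 = v" and wS: "w (Suc j) = w j - (fst (p (w j)) + snd (p (w j)))" for j
      by (simp_all add: w_def)
    have wn: "norm (w j) \<le> norm v * (1/2) ^ j" for j
    proof (induction j)
      case (Suc j)
      then show ?case using p(3)[of "w j"] by (simp add: wS)
    qed (simp add: w0)
    have "(\<lambda>j. (1/2::real) ^ j) \<longlonglongrightarrow> 0" by (rule LIMSEQ_power_zero) simp
    then have "(\<lambda>j. norm v * (1/2) ^ j) \<longlonglongrightarrow> 0" by (rule tendsto_mult_right_zero)
    then have wlim: "w \<longlonglongrightarrow> 0"
      by (rule Lim_null_comparison[rotated]) (rule always_eventually, rule allI, rule wn)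
    have mb: "norm (fst (p (w j))) \<le> K * norm v * (1/2) ^ j" for j
    proof -
      have "norm (fst (p (w j))) \<le> K * norm (w j)" by (rule p(4))
      also have "\<dots> \<le> K * (norm v * (1/2) ^ j)" by (rule mult_left_mono[OF wn K])
      finally show ?thesis by (simp add: mult.assoc)
    qed
    have geo: "(\<lambda>j. K * norm v * (1/2) ^ j) sums (K * norm v * 2)"
      using sums_mult[OF geometric_sums[of "1/2::real"], of "K * norm v"] by simp
    have sm: "summable (\<lambda>j. norm (fst (p (w j))))"
      by (rule summable_comparison_test'[OF sums_summable[OF geo], of 0]) (simp add: mb)
    define m where "m = (\<Sum>j. fst (p (w j)))"
    have mlim: "(\<lambda>n. \<Sum>j<n. fst (p (w j))) \<longlonglongrightarrow> m"
      unfolding m_def by (rule summable_LIMSEQ[OF summable_norm_cancel[OF sm]])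
    have "m \<in> M"
      by (rule closed_sequentially[OF M(2) _ mlim]) (simp add: p(1) M(1) subspace_sum)
    moreover have "v - m \<in> N"
    proof (rule closed_sequentially[OF N(2)])
      show "(\<Sum>j<n. snd (p (w j))) \<in> N" for n by (simp add: p(2) N(1) subspace_sum)
      have "(\<Sum>j<n. snd (p (w j))) = v - w n - (\<Sum>j<n. fst (p (w j)))" for n
        by (induction n) (simp_all add: w0 wS)
      moreover have "(\<lambda>n. v - w n - (\<Sum>j<n. fst (p (w j)))) \<longlonglongrightarrow> v - 0 - m"
        by (intro tendsto_intros wlim mlim)
      ultimately show "(\<lambda>n. \<Sum>j<n. snd (p (w j))) \<longlonglongrightarrow> v - m" by simp
    qed
    moreover have "norm m \<le> 2 * K * norm v"
    proof -
      have "norm m \<le> (\<Sum>j. norm (fst (p (w j))))" unfolding m_def by (rule summable_norm[OF sm])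
      also have "\<dots> \<le> (\<Sum>j. K * norm v * (1/2) ^ j)"
        by (rule suminf_le[OF mb sm sums_summable[OF geo]])
      also have "\<dots> = 2 * K * norm v" using sums_unique[OF geo] by simp
      finally show ?thesis .
    qed
    ultimately show ?thesis by blast
  qed
  show ?thesis
  proof (rule that[of "2 * K + 1"])
    show "2 * K + 1 > 0" using K by simp
    fix v m assume m: "m \<in> M" "v - m \<in> N"
    obtain m' where m': "m' \<in> M" "v - m' \<in> N" "norm m' \<le> 2 * K * norm v" using main by blast
    have "m - m' \<in> M" using m m' M(1) by (simp add: subspace_diff)
    moreover have "(v - m') - (v - m) \<in> N" using m m' N(1) by (simp only: subspace_diff)
    ultimately have "m - m' \<in> M \<inter> N" by simp
    then have "m = m'" using inter by simp
    then have "norm m \<le> 2 * K * norm v" using m'(3) by simp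
    then show "norm m \<le> (2 * K + 1) * norm v"
      using norm_ge_zero[of v] unfolding distrib_right mult_1 by linarith
  qed
qed

lemma skew_projection_bounded:
  fixes M N :: "'b::banach set"
  assumes M: "subspace M" "closed M" and N: "subspace N" "closed N"
    and inter: "M \<inter> N = {0}" and sum: "\<And>v. \<exists>m\<in>M. v - m \<in> N"
  obtains Q C where "linear Q" "\<And>v. Q v \<in> M" "\<And>m. m \<in> M \<Longrightarrow> Q m = m"
    "\<And>v. Q v = 0 \<longleftrightarrow> v \<in> N" "C > 0" "\<And>v. norm (Q v) \<le> C * norm v"
proof -
  obtain C where C: "C > 0" "\<And>v m. m \<in> M \<Longrightarrow> v - m \<in> N \<Longrightarrow> norm m \<le> C * norm v"
    using complement_bounded[OF assms] by metis
  obtain Q where Q: "\<And>v. Q v \<in> M" "\<And>v. v - Q v \<in> N" using sum by metis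
  have uniq: "Q v = m" if "m \<in> M" "v - m \<in> N" for v m
  proof -
    have "Q v - m \<in> M" using that Q M(1) by (simp add: subspace_diff)
    moreover have "(v - m) - (v - Q v) \<in> N" using that Q N(1) by (simp only: subspace_diff)
    ultimately have "Q v - m \<in> M \<inter> N" by simp
    then show ?thesis using inter by simp
  qed
  have "linear Q"
  proof (rule linearI)
    fix u v and r :: real
    have "(u - Q u) + (v - Q v) \<in> N" using Q N(1) by (simp only: subspace_add)
    then show "Q (u + v) = Q u + Q v"
      using Q M(1) by (intro uniq) (simp_all add: subspace_add algebra_simps)
    have "r *\<^sub>R (u - Q u) \<in> N" using Q N(1) by (simp only: subspace_scale)
    then show "Q (r *\<^sub>R u) = r *\<^sub>R Q u"
      using Q M(1) by (intro uniq) (simp_all add: subspace_scale algebra_simps)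
  qed
  moreover have "Q m = m" if "m \<in> M" for m using that N(1) by (intro uniq) (simp_all add: subspace_0)
  moreover have "Q v = 0 \<longleftrightarrow> v \<in> N" for v
    using Q(2)[of v] uniq[of 0 v] M(1) by (auto simp: subspace_0)
  moreover have "norm (Q v) \<le> C * norm v" for v using C(2) Q by blast
  ultimately show ?thesis using C(1) Q(1) by (intro that)
qed

text \<open>
  Writing \<open>Q\<close> for the projection onto \<open>M\<^sub>2\<close> along \<open>N\<^sub>2\<close>, the unique solvability of
  \<open>v - D x \<in> N\<^sub>2\<close> in \<open>x \<in> M\<^sub>1\<close> says that \<open>Q D\<close> maps \<open>M\<^sub>1\<close> bijectively onto \<open>M\<^sub>2\<close>. Both
  decompositions of the space that are needed later, \<open>M\<^sub>1 \<oplus> D\<^sup>-\<^sup>1(N\<^sub>2)\<close> and \<open>D(M\<^sub>1) \<oplus> N\<^sub>2\<close>,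
  can be read off from it.
\<close>

lemma complement_perturbation:
  fixes D\<^sub>0 :: "'b::banach \<Rightarrow> 'b"
  assumes D0: "linear D\<^sub>0" and M1: "subspace M\<^sub>1"
    and M2: "subspace M\<^sub>2" "closed M\<^sub>2" and N2: "subspace N\<^sub>2" "closed N\<^sub>2"
    and inter: "M\<^sub>2 \<inter> N\<^sub>2 = {0}" and sum: "\<And>v. \<exists>m\<in>M\<^sub>2. v - m \<in> N\<^sub>2"
    and img: "D\<^sub>0 ` M\<^sub>1 = M\<^sub>2" and c: "c > 0" "\<And>x. x \<in> M\<^sub>1 \<Longrightarrow> c * norm x \<le> norm (D\<^sub>0 x)"
  shows "\<exists>\<delta>>0. \<exists>\<kappa>>0. \<forall>D. linear D \<longrightarrow> (\<forall>u. norm (D u - D\<^sub>0 u) \<le> \<delta> * norm u) \<longrightarrow>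
    (\<forall>x\<in>M\<^sub>1. \<kappa> * norm x \<le> norm (D x)) \<and> (\<forall>v. \<exists>!x. x \<in> M\<^sub>1 \<and> v - D x \<in> N\<^sub>2)"
proof -
  obtain Q C where Q: "linear Q" "\<And>v. Q v \<in> M\<^sub>2" "\<And>m. m \<in> M\<^sub>2 \<Longrightarrow> Q m = m"
    "\<And>v. Q v = 0 \<longleftrightarrow> v \<in> N\<^sub>2" and C: "C > 0" "\<And>v. norm (Q v) \<le> C * norm v"
    using skew_projection_bounded[OF M2 N2 inter sum] by metis
  \<comment> \<open>This makes \<open>Q (D - D\<^sub>0)\<close> at most half as large as the lower bound \<open>c\<close> of \<open>D\<^sub>0\<close>.\<close>
  define \<delta> where "\<delta> = c / (2 * C)"
  define \<kappa> where "\<kappa> = c / (2 * C)"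
  have pos: "\<delta> > 0" "\<kappa> > 0" using c C by (simp_all add: \<delta>_def \<kappa>_def)
  have dev: "norm (Q (D u - D\<^sub>0 u)) \<le> c / 2 * norm u"
    if "\<And>u. norm (D u - D\<^sub>0 u) \<le> \<delta> * norm u" for D u
  proof -
    have "norm (Q (D u - D\<^sub>0 u)) \<le> C * (\<delta> * norm u)"
      using C(2)[of "D u - D\<^sub>0 u"] mult_left_mono[OF that[of u], of C] C(1) by linarith
    then show ?thesis using C(1) by (simp add: \<delta>_def)
  qed
  have below: "c / 2 * norm x \<le> norm (Q (D x))"
    if D: "\<And>u. norm (D u - D\<^sub>0 u) \<le> \<delta> * norm u" and x: "x \<in> M\<^sub>1" for D x
  proof -
    have "D\<^sub>0 x \<in> M\<^sub>2" using img x by blast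
    then have "D\<^sub>0 x = Q (D x) - Q (D x - D\<^sub>0 x)" by (simp add: linear_diff[OF Q(1)] Q(3))
    then have "norm (D\<^sub>0 x) \<le> norm (Q (D x)) + norm (Q (D x - D\<^sub>0 x))"
      by (metis norm_triangle_ineq4)
    then show ?thesis using dev[OF D, of x] c(2)[OF x] by linarith
  qed
  have lower: "\<kappa> * norm x \<le> norm (D x)"
    if D: "linear D" "\<And>u. norm (D u - D\<^sub>0 u) \<le> \<delta> * norm u" and x: "x \<in> M\<^sub>1" for D x
  proof -
    have "c / 2 * norm x \<le> C * norm (D x)" using below[OF D(2) x] C(2)[of "D x"] by linarith
    then show ?thesis using C(1) by (simp add: \<kappa>_def field_simps)
  qed
  have solve: "\<exists>!x. x \<in> M\<^sub>1 \<and> v - D x \<in> N\<^sub>2"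
    if D: "linear D" "\<And>u. norm (D u - D\<^sub>0 u) \<le> \<delta> * norm u" for D v
  proof -
    define G where "G = inv_into M\<^sub>1 D\<^sub>0"
    have G: "G y \<in> M\<^sub>1" "D\<^sub>0 (G y) = y" if "y \<in> M\<^sub>2" for y
      using that unfolding G_def img[symmetric] by (simp_all add: inv_into_into f_inv_into_f)
    \<comment> \<open>A fixed point \<open>y = D\<^sub>0 x\<close> satisfies \<open>Q (D x) = Q v\<close>.\<close>
    define \<Phi> where "\<Phi> y = Q v - Q (D (G y) - D\<^sub>0 (G y))" for y
    have "\<exists>!y\<in>M\<^sub>2. \<Phi> y = y"
    proof (rule Banach_fix)
      show "complete M\<^sub>2" using M2(2) by (simp add: complete_eq_closed)
      show "M\<^sub>2 \<noteq> {}" using M2(1) subspace_0 by blast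
      show "\<Phi> ` M\<^sub>2 \<subseteq> M\<^sub>2" using Q(2) M2(1) by (auto simp: \<Phi>_def intro: subspace_diff)
      show "0 \<le> (1/2::real)" "1/2 < (1::real)" by simp_all
      show "dist (\<Phi> y) (\<Phi> z) \<le> 1/2 * dist y z" if yz: "y \<in> M\<^sub>2" "z \<in> M\<^sub>2" for y z
      proof -
        let ?w = "G z - G y"
        have w: "?w \<in> M\<^sub>1" using G yz M1 by (simp add: subspace_diff)
        have "\<Phi> y - \<Phi> z = Q (D ?w - D\<^sub>0 ?w)"
          by (simp add: \<Phi>_def linear_diff[OF Q(1)] linear_diff[OF D(1)] linear_diff[OF D0])
        then have "dist (\<Phi> y) (\<Phi> z) \<le> c / 2 * norm ?w"
          using dev[OF D(2), of ?w] by (simp add: dist_norm)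
        moreover have "c * norm ?w \<le> dist y z"
          using c(2)[OF w] G yz by (simp add: linear_diff[OF D0] dist_norm norm_minus_commute)
        ultimately show ?thesis by linarith
      qed
    qed
    then obtain y where y: "y \<in> M\<^sub>2" "\<Phi> y = y" by blast
    have "Q (D (G y)) = Q v"
      using y(2) G[OF y(1)] Q(3)[OF y(1)] by (simp add: \<Phi>_def linear_diff[OF Q(1)])
    then have "Q (v - D (G y)) = 0" by (simp add: linear_diff[OF Q(1)])
    then have ex: "G y \<in> M\<^sub>1 \<and> v - D (G y) \<in> N\<^sub>2" using G[OF y(1)] Q(4) by simp
    show "\<exists>!x. x \<in> M\<^sub>1 \<and> v - D x \<in> N\<^sub>2"
    proof (rule ex1I)
      show "G y \<in> M\<^sub>1 \<and> v - D (G y) \<in> N\<^sub>2" by (rule ex)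
    next
      fix x assume x: "x \<in> M\<^sub>1 \<and> v - D x \<in> N\<^sub>2"
      have "(v - D (G y)) - (v - D x) \<in> N\<^sub>2" using x ex N2(1) by (simp only: subspace_diff)
      then have "Q (D (x - G y)) = 0" using Q(4) by (simp add: linear_diff[OF D(1)])
      moreover have "x - G y \<in> M\<^sub>1" using x ex M1 by (simp add: subspace_diff)
      ultimately have "c / 2 * norm (x - G y) \<le> 0" using below[OF D(2), of "x - G y"] by simp
      then show "x = G y" using c(1) by (simp add: mult_le_0_iff)
    qed
  qed
  show ?thesis
  proof (rule exI[of _ \<delta>], rule conjI[OF pos(1)], rule exI[of _ \<kappa>], rule conjI[OF pos(2)], intro allI impI)
    fix D assume "linear D" "\<forall>u. norm (D u - D\<^sub>0 u) \<le> \<delta> * norm u"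
    then show "(\<forall>x\<in>M\<^sub>1. \<kappa> * norm x \<le> norm (D x)) \<and> (\<forall>v. \<exists>!x. x \<in> M\<^sub>1 \<and> v - D x \<in> N\<^sub>2)"
      using lower[of D] solve[of D] by simp
  qed
qed

section \<open>Openness\<close>

lemma Metric_space_HA: "Metric_space (HA :: (nat \<Rightarrow> 'a::unital_cstar_algebra) set) (\<lambda>x y. norm_HA (x - y))"
proof
  fix x y z :: "nat \<Rightarrow> 'a"
  show "norm_HA (x - y) \<ge> 0" by (simp add: norm_HA_def)
  have "inner_HA (x - y) (x - y) = inner_HA (y - x) (y - x)"
    by (simp add: inner_HA_def star_diff algebra_simps)
  then show "norm_HA (x - y) = norm_HA (y - x)" by (simp add: norm_HA_def)
  assume x: "x \<in> HA" and y: "y \<in> HA"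
  show "norm_HA (x - y) = 0 \<longleftrightarrow> x = y"
    using norm_HA_eq_0[OF HA_diff[OF x y]] by auto
  assume z: "z \<in> HA"
  show "norm_HA (x - z) \<le> norm_HA (x - y) + norm_HA (y - z)"
    using norm_HA_triangle[OF HA_diff[OF x y] HA_diff[OF y z]] by simp
qed

definition hset :: "(nat \<Rightarrow> 'a::unital_cstar_algebra) set \<Rightarrow> 'a hmod set" where
  "hset M = {u. Rep_hmod u \<in> M}"

lemma norm_HA_Rep: "norm_HA (Rep_hmod u) = norm u"
  by (simp add: norm_hmod_def)

lemma closedin_HA_topology:
  assumes "M \<subseteq> HA" shows "closedin HA_topology M \<longleftrightarrow> closed (hset M)"
proof -
  interpret H: Metric_space "HA :: (nat \<Rightarrow> 'a) set" "\<lambda>x y. norm_HA (x - y)"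
    by (rule Metric_space_HA)
  have ball: "disjnt M (H.mball (Rep_hmod u) r) \<longleftrightarrow> ball u r \<subseteq> - hset M" for u r
  proof -
    have "ball u r \<subseteq> - hset M \<longleftrightarrow> (\<forall>v. norm (u - v) < r \<longrightarrow> Rep_hmod v \<notin> M)"
      by (auto simp: hset_def dist_norm)
    also have "\<dots> \<longleftrightarrow> (\<forall>y\<in>HA. norm_HA (Rep_hmod u - y) < r \<longrightarrow> y \<notin> M)"
      by (metis Rep_HA Abs_HA Rep_diff norm_HA_Rep)
    finally show ?thesis by (auto simp: disjnt_iff H.in_mball)
  qed
  have "closedin HA_topology M \<longleftrightarrow> (\<forall>x\<in>HA - M. \<exists>r>0. disjnt M (H.mball x r))"
    using assms by (simp add: HA_topology_def H.closedin_metric Ball_def)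
  also have "\<dots> \<longleftrightarrow> (\<forall>u\<in>- hset M. \<exists>r>0. disjnt M (H.mball (Rep_hmod u) r))"
    unfolding hset_def by (metis (mono_tags, lifting) Abs_HA ComplD ComplI DiffD1 DiffD2 DiffI Rep_HA mem_Collect_eq)
  also have "\<dots> \<longleftrightarrow> closed (hset M)"
    by (simp add: ball closed_def open_contains_ball)
  finally show ?thesis .
qed

lemma closed_submodule_subspace:
  assumes "closed_submodule M" shows "subspace (hset M)" "closed (hset M)"
proof -
  have M: "M \<subseteq> HA" "0 \<in> M" "\<And>x y. x \<in> M \<Longrightarrow> y \<in> M \<Longrightarrow> x + y \<in> M" "\<And>x a. x \<in> M \<Longrightarrow> ract x a \<in> M"
    "closedin HA_topology M"
    using assms by (auto simp: closed_submodule_def)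
  show "closed (hset M)" using M closedin_HA_topology by blast
  have "(\<lambda>i. r *\<^sub>R x i) \<in> M" if "x \<in> M" for r x
    using M(4)[OF that, of "r *\<^sub>R 1"] by (simp add: ract_scaleR_one)
  then show "subspace (hset M)"
    using M by (auto simp: subspace_def hset_def Rep_simps)
qed

lemma closed_submodule_diff:
  assumes "closed_submodule M" "x \<in> M" "y \<in> M" shows "x - y \<in> M"
proof -
  have "ract y (- 1) \<in> M" using assms by (auto simp: closed_submodule_def)
  moreover have "ract y (- 1) = - y" by (auto simp: ract_def)
  ultimately have "x + - y \<in> M" using assms unfolding closed_submodule_def by metis
  then show ?thesis by simp
qed

text \<open>
  The class \<open>Ba\<close> consists of extensional functions, and a pointwise difference of two of them
  need not be extensional. The operator norm is applied to such differences, so its properties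
  are proved for this larger class.
\<close>

definition operator_on_HA :: "((nat \<Rightarrow> 'a::unital_cstar_algebra) \<Rightarrow> (nat \<Rightarrow> 'a)) \<Rightarrow> bool" where
  "operator_on_HA T \<longleftrightarrow> T \<in> HA \<rightarrow> HA \<and> A_linear_on HA T \<and> bounded_on HA T"

definition hop :: "((nat \<Rightarrow> 'a::unital_cstar_algebra) \<Rightarrow> (nat \<Rightarrow> 'a)) \<Rightarrow> 'a hmod \<Rightarrow> 'a hmod" where
  "hop T u = Abs_hmod (T (Rep_hmod u))"

lemma Ba_operator: "T \<in> Ba \<Longrightarrow> operator_on_HA T"
  by (auto simp: Ba_def operator_on_HA_def PiE_def)

lemma Rep_hop: "operator_on_HA T \<Longrightarrow> Rep_hmod (hop T u) = T (Rep_hmod u)"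
  by (auto simp: hop_def operator_on_HA_def Pi_iff)

lemma bounded_linear_hop:
  assumes "operator_on_HA T" shows "bounded_linear (hop T)"
proof -
  have lin: "T (x + y) = T x + T y" "T (ract x a) = ract (T x) a" if "x \<in> HA" "y \<in> HA" for x y a
    using assms that by (auto simp: operator_on_HA_def A_linear_on_def)
  obtain C where C: "\<And>x. x \<in> HA \<Longrightarrow> norm_HA (T x) \<le> C * norm_HA x"
    using assms unfolding operator_on_HA_def bounded_on_def by blast
  show ?thesis
  proof (rule bounded_linear_intro[where K = C])
    fix u v :: "'a hmod" and r :: real
    show "hop T (u + v) = hop T u + hop T v"
      by (simp add: Rep_hmod_inject[symmetric] Rep_hop[OF assms] Rep_simps lin)
    show "hop T (r *\<^sub>R u) = r *\<^sub>R hop T u"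
      using lin(2)[OF Rep_HA Rep_HA, of u "r *\<^sub>R 1"]
      by (simp add: Rep_hmod_inject[symmetric] Rep_hop[OF assms] Rep_simps ract_scaleR_one)
    show "norm (hop T u) \<le> norm u * C"
      using C[OF Rep_HA[of u]] by (simp add: norm_hmod_def Rep_hop[OF assms] mult.commute)
  qed
qed

lemma operator_on_HA_diff:
  assumes S: "operator_on_HA S" and T: "operator_on_HA T" shows "operator_on_HA (S - T)"
proof -
  have maps: "S x \<in> HA" "T x \<in> HA" if "x \<in> HA" for x
    using assms that by (auto simp: operator_on_HA_def)
  have "S x - T x \<in> HA" if "x \<in> HA" for x using maps[OF that] by (rule HA_diff)
  moreover have "A_linear_on HA (S - T)"
    using assms by (auto simp: operator_on_HA_def A_linear_on_def ract_def fun_eq_iff left_diff_distrib)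
  moreover have "bounded_on HA (S - T)"
  proof -
    obtain C where C: "\<And>x. x \<in> HA \<Longrightarrow> norm_HA (S x) \<le> C * norm_HA x"
      using S unfolding operator_on_HA_def bounded_on_def by blast
    obtain C' where C': "\<And>x. x \<in> HA \<Longrightarrow> norm_HA (T x) \<le> C' * norm_HA x"
      using T unfolding operator_on_HA_def bounded_on_def by blast
    have "norm_HA (S x - T x) \<le> (C + C') * norm_HA x" if x: "x \<in> HA" for x
    proof -
      have "norm_HA (S x - T x) = norm (Abs_hmod (S x) - Abs_hmod (T x))"
        using maps[OF x] by (simp add: norm_hmod_def Rep_simps)
      also have "\<dots> \<le> norm (Abs_hmod (S x)) + norm (Abs_hmod (T x))" by (rule norm_triangle_ineq4)
      also have "\<dots> = norm_HA (S x) + norm_HA (T x)" using maps[OF x] by (simp add: norm_hmod_def)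
      finally show ?thesis using C[OF x] C'[OF x] by (simp add: distrib_right)
    qed
    then show ?thesis by (auto simp: bounded_on_def)
  qed
  ultimately show ?thesis by (auto simp: operator_on_HA_def)
qed

lemma hop_diff:
  assumes "operator_on_HA S" "operator_on_HA T" shows "hop (S - T) u = hop S u - hop T u"
  by (simp add: Rep_hmod_inject[symmetric] Rep_simps Rep_hop assms operator_on_HA_diff fun_eq_iff)

lemma opnorm_leI:
  assumes T: "operator_on_HA T" and C: "C \<ge> 0" "\<And>u. norm (hop T u) \<le> C * norm u"
  shows "opnorm T \<le> C"
proof -
  have "(SUP x\<in>{x \<in> HA. norm_HA x \<le> 1}. ennreal (norm_HA (T x))) \<le> ennreal C"
  proof (rule SUP_least)
    fix x :: "nat \<Rightarrow> 'a" assume "x \<in> {x \<in> HA. norm_HA x \<le> 1}"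
    then have x: "x \<in> HA" "norm_HA x \<le> 1" by auto
    have "norm_HA (T x) \<le> C * norm_HA x"
      using C(2)[of "Abs_hmod x"] x(1) by (simp add: norm_hmod_def Rep_hop[OF T])
    also have "\<dots> \<le> C" using C(1) x(2) by (simp add: mult_left_le)
    finally show "ennreal (norm_HA (T x)) \<le> ennreal C" by (rule ennreal_leI)
  qed
  then show ?thesis unfolding opnorm_def by (rule enn2real_leI[OF C(1)])
qed

lemma norm_hop_le:
  assumes T: "operator_on_HA T" shows "norm (hop T u) \<le> opnorm T * norm u"
proof -
  interpret bounded_linear "hop T" by (rule bounded_linear_hop[OF T])
  let ?S = "SUP x\<in>{x \<in> HA. norm_HA x \<le> 1}. ennreal (norm_HA (T x))"
  obtain C where C: "C > 0" "\<And>u. norm (hop T u) \<le> norm u * C"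
    using pos_bounded by blast
  have "?S \<le> ennreal C"
  proof (rule SUP_least)
    fix x :: "nat \<Rightarrow> 'a" assume "x \<in> {x \<in> HA. norm_HA x \<le> 1}"
    then have x: "x \<in> HA" "norm_HA x \<le> 1" by auto
    have "norm_HA (T x) \<le> norm_HA x * C"
      using C(2)[of "Abs_hmod x"] x(1) by (simp add: norm_hmod_def Rep_hop[OF T])
    also have "\<dots> \<le> C" using C(1) x(2) by (simp add: mult_left_le mult.commute)
    finally show "ennreal (norm_HA (T x)) \<le> ennreal C" by (rule ennreal_leI)
  qed
  then have "?S < top" by (rule le_less_trans) (rule ennreal_less_top)
  then have S: "?S = ennreal (opnorm T)"
    unfolding opnorm_def by (rule ennreal_enn2real[symmetric])
  have unit: "norm (hop T v) \<le> opnorm T" if v: "norm v \<le> 1" for v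
  proof -
    have "ennreal (norm_HA (T (Rep_hmod v))) \<le> ?S"
      using v by (intro SUP_upper) (simp add: norm_HA_Rep)
    then have "ennreal (norm (hop T v)) \<le> ennreal (opnorm T)"
      by (simp add: S norm_hmod_def Rep_hop[OF T])
    then show ?thesis by (simp add: opnorm_def ennreal_le_iff)
  qed
  show ?thesis
  proof (cases "u = 0")
    case False
    have "norm (hop T (u /\<^sub>R norm u)) \<le> opnorm T" by (rule unit) (simp add: False)
    then show ?thesis using False by (simp add: scaleR field_simps)
  qed (simp add: zero)
qed

lemma Metric_space_Ba:
  "Metric_space (Ba :: ((nat \<Rightarrow> 'a::unital_cstar_algebra) \<Rightarrow> (nat \<Rightarrow> 'a)) set) (\<lambda>S T. opnorm (S - T))"
proof
  fix S T U :: "(nat \<Rightarrow> 'a) \<Rightarrow> (nat \<Rightarrow> 'a)"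
  show nn: "opnorm (S - T) \<ge> 0" for S T :: "(nat \<Rightarrow> 'a) \<Rightarrow> (nat \<Rightarrow> 'a)" by (simp add: opnorm_def)
  have "inner_HA (x - y) (x - y) = inner_HA (y - x) (y - x)" for x y :: "nat \<Rightarrow> 'a"
    by (simp add: inner_HA_def star_diff algebra_simps)
  then show "opnorm (S - T) = opnorm (T - S)" by (simp add: opnorm_def norm_HA_def)
  assume S: "S \<in> Ba" and T: "T \<in> Ba"
  have oST: "operator_on_HA (S - T)" using S T by (simp add: Ba_operator operator_on_HA_diff)
  show "opnorm (S - T) = 0 \<longleftrightarrow> S = T"
  proof
    assume 0: "opnorm (S - T) = 0"
    have ext: "S x = T x" if "x \<in> HA" for x
    proof -
      have "hop S (Abs_hmod x) = hop T (Abs_hmod x)"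
        using norm_hop_le[OF oST, of "Abs_hmod x"] S T by (simp add: 0 hop_diff Ba_operator)
      then have "Rep_hmod (hop S (Abs_hmod x)) = Rep_hmod (hop T (Abs_hmod x))" by simp
      then show ?thesis using S T that by (simp add: Rep_hop Ba_operator)
    qed
    have "S \<in> extensional HA" "T \<in> extensional HA" using S T by (auto simp: Ba_def PiE_def)
    then show "S = T" using ext by (rule extensionalityI)
  next
    assume eq: "S = T"
    have "hop (S - T) u = 0" for u
      using hop_diff[OF Ba_operator[OF S] Ba_operator[OF T], of u] eq by simp
    then have "opnorm (S - T) \<le> 0" by (intro opnorm_leI[OF oST]) simp_all
    then show "opnorm (S - T) = 0" using nn[of S T] by linarith
  qed
  assume U: "U \<in> Ba"
  have o: "operator_on_HA S" "operator_on_HA T" "operator_on_HA U" using S T U by (simp_all add: Ba_operator)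
  show "opnorm (S - U) \<le> opnorm (S - T) + opnorm (T - U)"
  proof (rule opnorm_leI)
    show "operator_on_HA (S - U)" using o by (simp add: operator_on_HA_diff)
    show "0 \<le> opnorm (S - T) + opnorm (T - U)" using nn by simp
    fix u
    have "hop (S - U) u = hop (S - T) u + hop (T - U) u" using o by (simp add: hop_diff)
    then have "norm (hop (S - U) u) \<le> norm (hop (S - T) u) + norm (hop (T - U) u)"
      by (simp add: norm_triangle_ineq)
    then show "norm (hop (S - U) u) \<le> (opnorm (S - T) + opnorm (T - U)) * norm u"
      using norm_hop_le[OF operator_on_HA_diff[OF o(1,2)], of u]
        norm_hop_le[OF operator_on_HA_diff[OF o(2,3)], of u] by (simp add: distrib_right)
  qed
qed

lemma direct_sum_HA_iff:
  "direct_sum M N HA \<longleftrightarrow> closed_submodule M \<and> closed_submodule N \<and> M \<inter> N = {0} \<and>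
     (\<forall>v\<in>HA. \<exists>m\<in>M. v - m \<in> N)"
proof (cases "closed_submodule M \<and> closed_submodule N")
  case True
  then have sub: "M \<subseteq> HA" "N \<subseteq> HA" by (auto simp: closed_submodule_def)
  have "HA = {x + y |x y. x \<in> M \<and> y \<in> N} \<longleftrightarrow> (\<forall>v\<in>HA. \<exists>m\<in>M. v - m \<in> N)"
  proof
    assume eq: "HA = {x + y |x y. x \<in> M \<and> y \<in> N}"
    show "\<forall>v\<in>HA. \<exists>m\<in>M. v - m \<in> N"
    proof
      fix v :: "nat \<Rightarrow> 'a" assume "v \<in> HA"
      then obtain x y where "v = x + y" "x \<in> M" "y \<in> N" using eq by blast
      then show "\<exists>m\<in>M. v - m \<in> N" by (intro bexI[of _ x]) auto
    qed
  next
    assume a: "\<forall>v\<in>HA. \<exists>m\<in>M. v - m \<in> N"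
    show "HA = {x + y |x y. x \<in> M \<and> y \<in> N}"
    proof (intro equalityI subsetI)
      fix v :: "nat \<Rightarrow> 'a" assume "v \<in> HA"
      then obtain m where "m \<in> M" "v - m \<in> N" using a by blast
      moreover have "v = m + (v - m)" by simp
      ultimately show "v \<in> {x + y |x y. x \<in> M \<and> y \<in> N}" by blast
    next
      fix v assume "v \<in> {x + y |x y. x \<in> M \<and> y \<in> N}"
      then show "v \<in> HA" using sub HA_add by blast
    qed
  qed
  then show ?thesis using True by (simp add: direct_sum_def)
qed (auto simp: direct_sum_def)

lemma hset_eq_image: "M \<subseteq> HA \<Longrightarrow> hset M = Abs_hmod ` M"
  by (force simp: hset_def image_iff)

text \<open>
  Both \<open>M\<^sub>1\<close> and \<open>N\<^sub>2\<close> are kept, so that every condition depending on these two alone survives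
  the perturbation. Closedness of \<open>D(M\<^sub>1)\<close> comes from the lower bound for \<open>D\<close> on \<open>M\<^sub>1\<close>. The
  preimage of \<open>N\<^sub>2\<close> is the kernel of \<open>Q D\<close> for the projection \<open>Q\<close> onto \<open>M\<^sub>2\<close> along \<open>N\<^sub>2\<close>.
\<close>

lemma module_iso_perturbation:
  assumes D0: "D\<^sub>0 \<in> Ba" and dec: "diagonal_decomposition D\<^sub>0 M\<^sub>1 N\<^sub>1 M\<^sub>2 N\<^sub>2" and iso: "module_iso D\<^sub>0 M\<^sub>1 M\<^sub>2"
  shows "\<exists>\<delta>>0. \<forall>D\<in>Ba. opnorm (D\<^sub>0 - D) < \<delta> \<longrightarrow>
    diagonal_decomposition D M\<^sub>1 {x \<in> HA. D x \<in> N\<^sub>2} (D ` M\<^sub>1) N\<^sub>2 \<and> module_iso D M\<^sub>1 (D ` M\<^sub>1)"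
proof -
  have ds: "direct_sum M\<^sub>1 N\<^sub>1 HA" "direct_sum M\<^sub>2 N\<^sub>2 HA"
    using dec by (auto simp: diagonal_decomposition_def)
  have M1: "closed_submodule M\<^sub>1" and M2: "closed_submodule M\<^sub>2" and N2: "closed_submodule N\<^sub>2"
    and inter: "M\<^sub>2 \<inter> N\<^sub>2 = {0}" and sum: "\<And>v. v \<in> HA \<Longrightarrow> \<exists>m\<in>M\<^sub>2. v - m \<in> N\<^sub>2"
    using ds unfolding direct_sum_HA_iff by auto
  have M1HA: "M\<^sub>1 \<subseteq> HA" and M2HA: "M\<^sub>2 \<subseteq> HA"
    using M1 M2 by (auto simp: closed_submodule_def)
  note o0 = Ba_operator[OF D0]
  obtain C where C: "\<And>y. y \<in> M\<^sub>2 \<Longrightarrow> norm_HA (inv_into M\<^sub>1 D\<^sub>0 y) \<le> C * norm_HA y"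
    using iso unfolding module_iso_def bounded_on_def by blast
  have bij: "bij_betw D\<^sub>0 M\<^sub>1 M\<^sub>2" using iso by (simp add: module_iso_def)
  define c where "c = 1 / (\<bar>C\<bar> + 1)"
  have c: "c > 0" by (simp add: c_def add_nonneg_pos)
  have below: "c * norm u \<le> norm (hop D\<^sub>0 u)" if "u \<in> hset M\<^sub>1" for u
  proof -
    have u: "Rep_hmod u \<in> M\<^sub>1" using that by (simp add: hset_def)
    then have "norm_HA (Rep_hmod u) \<le> C * norm_HA (D\<^sub>0 (Rep_hmod u))"
      using C[of "D\<^sub>0 (Rep_hmod u)"] bij
      by (metis bij_betw_apply bij_betw_imp_inj_on inv_into_f_f)
    then have "norm u \<le> C * norm (hop D\<^sub>0 u)" by (simp add: norm_hmod_def Rep_hop[OF o0])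
    also have "\<dots> \<le> (\<bar>C\<bar> + 1) * norm (hop D\<^sub>0 u)" by (rule mult_right_mono) auto
    finally show ?thesis
      by (simp add: c_def divide_le_eq mult.commute add_nonneg_pos)
  qed
  have img: "hop D\<^sub>0 ` hset M\<^sub>1 = hset M\<^sub>2"
  proof -
    have "hop D\<^sub>0 ` hset M\<^sub>1 = Abs_hmod ` (D\<^sub>0 ` M\<^sub>1)"
      using M1HA by (auto simp: hset_eq_image image_image hop_def subset_iff intro!: image_cong)
    then show ?thesis using bij M2HA by (simp add: bij_betw_def hset_eq_image)
  qed
  have hinter: "hset M\<^sub>2 \<inter> hset N\<^sub>2 = {0}"
    using inter by (force simp: hset_def Rep_hmod_inject[symmetric] Rep_zero)
  have hsum: "\<exists>m\<in>hset M\<^sub>2. v - m \<in> hset N\<^sub>2" for v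
  proof -
    obtain m where "m \<in> M\<^sub>2" "Rep_hmod v - m \<in> N\<^sub>2" using sum[OF Rep_HA] by blast
    then show ?thesis using M2HA
      by (intro bexI[of _ "Abs_hmod m"]) (auto simp: hset_def Rep_simps subset_iff)
  qed
  have "\<exists>\<delta>>0. \<exists>\<kappa>>0. \<forall>D. linear D \<longrightarrow> (\<forall>u. norm (D u - hop D\<^sub>0 u) \<le> \<delta> * norm u) \<longrightarrow>
      (\<forall>x\<in>hset M\<^sub>1. \<kappa> * norm x \<le> norm (D x)) \<and> (\<forall>v. \<exists>!x. x \<in> hset M\<^sub>1 \<and> v - D x \<in> hset N\<^sub>2)"
    by (rule complement_perturbation[OF bounded_linear.linear[OF bounded_linear_hop[OF o0]]
        closed_submodule_subspace(1)[OF M1] closed_submodule_subspace[OF M2]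
        closed_submodule_subspace[OF N2] hinter hsum img c below])
  then obtain \<delta> \<kappa> where \<delta>: "\<delta> > 0" and \<kappa>: "\<kappa> > 0" and
    stable: "\<And>D. linear D \<Longrightarrow> (\<And>u. norm (D u - hop D\<^sub>0 u) \<le> \<delta> * norm u) \<Longrightarrow>
      (\<forall>x\<in>hset M\<^sub>1. \<kappa> * norm x \<le> norm (D x)) \<and> (\<forall>v. \<exists>!x. x \<in> hset M\<^sub>1 \<and> v - D x \<in> hset N\<^sub>2)"
    by blast
  show ?thesis
  proof (rule exI[of _ \<delta>], intro conjI \<delta> ballI impI)
    fix D assume D: "D \<in> Ba" and near: "opnorm (D\<^sub>0 - D) < \<delta>"
    note oD = Ba_operator[OF D]
    note bl = bounded_linear_hop[OF oD]
    note lin = bounded_linear.linear[OF bl]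
    have dev: "norm (hop D u - hop D\<^sub>0 u) \<le> \<delta> * norm u" for u
    proof -
      have "norm (hop D u - hop D\<^sub>0 u) \<le> opnorm (D\<^sub>0 - D) * norm u"
        using norm_hop_le[OF operator_on_HA_diff[OF o0 oD], of u] hop_diff[OF o0 oD, of u]
        by (simp add: norm_minus_commute)
      also have "\<dots> \<le> \<delta> * norm u" using near by (intro mult_right_mono) auto
      finally show ?thesis .
    qed
    have lower: "\<kappa> * norm x \<le> norm (hop D x)" if "x \<in> hset M\<^sub>1" for x
      using stable[OF lin dev] that by blast
    have solve: "\<exists>!x. x \<in> hset M\<^sub>1 \<and> v - hop D x \<in> hset N\<^sub>2" for v
      using stable[OF lin dev] by blast
    have DHA: "D x \<in> HA" if "x \<in> HA" for x
      using oD that by (auto simp: operator_on_HA_def)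
    have Dadd: "D (x + y) = D x + D y" and Dract: "D (ract x a) = ract (D x) a" if "x \<in> HA" "y \<in> HA" for x y a
      using oD that by (auto simp: operator_on_HA_def A_linear_on_def)
    have Ddiff: "D (x - y) = D x - D y" if "x \<in> HA" "y \<in> HA" for x y
      using Dadd[OF HA_diff[OF that] that(2)] by simp
    have Dzero: "D 0 = 0" using Dadd[OF HA_zero HA_zero] by simp

    have lowerD: "\<kappa> * norm_HA x \<le> norm_HA (D x)" if "x \<in> M\<^sub>1" for x
    proof -
      have "Rep_hmod (Abs_hmod x) = x" using that M1HA by auto
      then show ?thesis using lower[of "Abs_hmod x"] that
        by (simp add: hset_def norm_hmod_def Rep_hop[OF oD])
    qed
    have ex: "\<exists>x\<in>M\<^sub>1. v - D x \<in> N\<^sub>2" if "v \<in> HA" for v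
      using solve[of "Abs_hmod v"] that
      by (auto simp: hset_def Rep_simps Rep_hop[OF oD])
    have zero: "x = 0" if "x \<in> M\<^sub>1" "D x \<in> N\<^sub>2" for x
    proof -
      have "Rep_hmod (Abs_hmod x) = x" using that M1HA by auto
      then have "Abs_hmod x \<in> hset M\<^sub>1 \<and> hop D (Abs_hmod x) - hop D (Abs_hmod x) \<in> hset N\<^sub>2"
        "0 \<in> hset M\<^sub>1 \<and> hop D (Abs_hmod x) - hop D 0 \<in> hset N\<^sub>2"
        using that closed_submodule_subspace(1)[OF M1] closed_submodule_subspace(1)[OF N2]
        by (auto simp: hset_def Rep_hop[OF oD] linear_0[OF lin] subspace_0 Rep_simps Dzero)
          (use M1 N2 in \<open>auto simp: closed_submodule_def\<close>)
      then have "Abs_hmod x = 0" using solve[of "hop D (Abs_hmod x)"] by blast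
      then show ?thesis using \<open>Rep_hmod (Abs_hmod x) = x\<close> by (simp add: Rep_zero)
    qed
    have N1': "closed_submodule {x \<in> HA. D x \<in> N\<^sub>2}"
    proof -
      have "hset {x \<in> HA. D x \<in> N\<^sub>2} = hop D -` hset N\<^sub>2"
        by (auto simp: hset_def Rep_hop[OF oD])
      then have "closed (hset {x \<in> HA. D x \<in> N\<^sub>2})"
        using closed_vimage[OF closed_submodule_subspace(2)[OF N2] linear_continuous_on[OF bl]]
        by simp
      then show ?thesis
        using N2 unfolding closed_submodule_def
        by (auto simp: closedin_HA_topology HA_zero HA_add HA_ract Dadd Dract Dzero)
    qed
    have M2': "closed_submodule (D ` M\<^sub>1)"
    proof -
      have "complete (hop D ` hset M\<^sub>1)"
        using closed_submodule_subspace[OF M1] lower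
        by (intro complete_isometric_image[OF \<kappa> _ bl]) (auto simp: complete_eq_closed)
      moreover have "hset (D ` M\<^sub>1) = hop D ` hset M\<^sub>1"
        using M1HA DHA by (subst hset_eq_image)
          (auto simp: hset_eq_image image_image hop_def subset_iff intro!: image_cong)
      ultimately have "closed (hset (D ` M\<^sub>1))" by (simp add: complete_eq_closed)
      moreover have sub: "D ` M\<^sub>1 \<subseteq> HA" using M1HA DHA by auto
      moreover have "0 \<in> D ` M\<^sub>1" using M1 Dzero by (force simp: closed_submodule_def image_iff)
      moreover have "D x + D y \<in> D ` M\<^sub>1" if "x \<in> M\<^sub>1" "y \<in> M\<^sub>1" for x y
      proof -
        have "x + y \<in> M\<^sub>1" using M1 that by (simp add: closed_submodule_def)
        then show ?thesis using Dadd[of x y] that M1HA by (metis image_eqI subsetD)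
      qed
      moreover have "ract (D x) a \<in> D ` M\<^sub>1" if "x \<in> M\<^sub>1" for x a
      proof -
        have "ract x a \<in> M\<^sub>1" using M1 that by (simp add: closed_submodule_def)
        then show ?thesis using Dract[of x x a] that M1HA by (metis image_eqI subsetD)
      qed
      ultimately show ?thesis unfolding closed_submodule_def
        by (auto simp: closedin_HA_topology)
    qed
    have "direct_sum M\<^sub>1 {x \<in> HA. D x \<in> N\<^sub>2} HA"
      unfolding direct_sum_HA_iff
    proof (intro conjI M1 N1' ballI)
      show "M\<^sub>1 \<inter> {x \<in> HA. D x \<in> N\<^sub>2} = {0}"
        using zero M1 N2 Dzero by (auto simp: closed_submodule_def HA_zero)
      fix v :: "nat \<Rightarrow> 'a" assume v: "v \<in> HA"
      obtain x where x: "x \<in> M\<^sub>1" "D v - D x \<in> N\<^sub>2" using ex[OF DHA[OF v]] by blast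
      have "x \<in> HA" using x(1) M1HA by blast
      then show "\<exists>m\<in>M\<^sub>1. v - m \<in> {x \<in> HA. D x \<in> N\<^sub>2}"
        using x v by (intro bexI[of _ x]) (auto simp: HA_diff Ddiff)
    qed
    moreover have "direct_sum (D ` M\<^sub>1) N\<^sub>2 HA"
      unfolding direct_sum_HA_iff
    proof (intro conjI M2' N2 ballI)
      show "D ` M\<^sub>1 \<inter> N\<^sub>2 = {0}"
        using zero M2' N2 Dzero by (auto simp: closed_submodule_def)
      fix v :: "nat \<Rightarrow> 'a" assume "v \<in> HA"
      then show "\<exists>m\<in>D ` M\<^sub>1. v - m \<in> N\<^sub>2" using ex by blast
    qed
    moreover have "module_iso D M\<^sub>1 (D ` M\<^sub>1)"
      unfolding module_iso_def
    proof (intro conjI)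
      show "A_linear_on M\<^sub>1 D"
        using M1HA Dadd Dract unfolding A_linear_on_def by (meson subsetD)
      show "bounded_on M\<^sub>1 D"
        using oD M1HA unfolding operator_on_HA_def bounded_on_def by (meson subsetD)
      have inj: "inj_on D M\<^sub>1"
      proof (rule inj_onI)
        fix x y assume xy: "x \<in> M\<^sub>1" "y \<in> M\<^sub>1" "D x = D y"
        then have "D (x - y) = 0" using Ddiff[of x y] M1HA by (simp add: subset_iff)
        moreover have "0 \<in> N\<^sub>2" using N2 by (simp add: closed_submodule_def)
        ultimately have "x - y = 0"
          using zero[OF closed_submodule_diff[OF M1 xy(1,2)]] by simp
        then show "x = y" by simp
      qed
      then show "bij_betw D M\<^sub>1 (D ` M\<^sub>1)" by (simp add: bij_betw_def)
      show "bounded_on (D ` M\<^sub>1) (inv_into M\<^sub>1 D)"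
        unfolding bounded_on_def
      proof (intro exI[of _ "1 / \<kappa>"] ballI)
        fix y assume "y \<in> D ` M\<^sub>1"
        then obtain x where x: "x \<in> M\<^sub>1" "y = D x" by blast
        then show "norm_HA (inv_into M\<^sub>1 D y) \<le> 1 / \<kappa> * norm_HA y"
          using lowerD[OF x(1)] inj \<kappa> by (simp add: field_simps)
      qed
    qed
    ultimately show "diagonal_decomposition D M\<^sub>1 {x \<in> HA. D x \<in> N\<^sub>2} (D ` M\<^sub>1) N\<^sub>2"
      "module_iso D M\<^sub>1 (D ` M\<^sub>1)"
      by (auto simp: diagonal_decomposition_def)
  qed
qed

theorem mainTheorem8:
  "openin (Ba_topology :: ((nat \<Rightarrow> 'a::unital_cstar_algebra) \<Rightarrow> (nat \<Rightarrow> 'a)) topology)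
     MPhi_hat_minus_plus"
proof -
  interpret B: Metric_space "Ba :: ((nat \<Rightarrow> 'a) \<Rightarrow> (nat \<Rightarrow> 'a)) set" "\<lambda>S T. opnorm (S - T)"
    by (rule Metric_space_Ba)
  have "\<exists>r>0. B.mball D\<^sub>0 r \<subseteq> MPhi_hat_minus_plus" if "D\<^sub>0 \<in> MPhi_hat_minus_plus"
    for D\<^sub>0 :: "(nat \<Rightarrow> 'a) \<Rightarrow> (nat \<Rightarrow> 'a)"
  proof -
    obtain M\<^sub>1 N\<^sub>1 M\<^sub>2 N\<^sub>2 where D0: "D\<^sub>0 \<in> Ba"
      and dec: "diagonal_decomposition D\<^sub>0 M\<^sub>1 N\<^sub>1 M\<^sub>2 N\<^sub>2" "module_iso D\<^sub>0 M\<^sub>1 M\<^sub>2"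
      and rest: "finitely_generated N\<^sub>2"
        "\<exists>N K. direct_sum M\<^sub>1 N K \<and> direct_sum K N\<^sub>2 HA \<and> (\<exists>P\<in>Ba. projection_onto_along P K N\<^sub>2)"
      using \<open>D\<^sub>0 \<in> MPhi_hat_minus_plus\<close> unfolding MPhi_hat_minus_plus_def by blast
    obtain \<delta> where \<delta>: "\<delta> > 0" "\<forall>D\<in>Ba. opnorm (D\<^sub>0 - D) < \<delta> \<longrightarrow>
        diagonal_decomposition D M\<^sub>1 {x \<in> HA. D x \<in> N\<^sub>2} (D ` M\<^sub>1) N\<^sub>2 \<and> module_iso D M\<^sub>1 (D ` M\<^sub>1)"
      using module_iso_perturbation[OF D0 dec] by (elim exE conjE)
    have "D \<in> MPhi_hat_minus_plus" if "D \<in> B.mball D\<^sub>0 \<delta>" for D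
    proof -
      have D: "D \<in> Ba" "opnorm (D\<^sub>0 - D) < \<delta>" using that by simp_all
      show ?thesis
        unfolding MPhi_hat_minus_plus_def mem_Collect_eq
        by (rule conjI[OF D(1)], rule exI[of _ M\<^sub>1], rule exI[of _ "{x \<in> HA. D x \<in> N\<^sub>2}"],
            rule exI[of _ "D ` M\<^sub>1"], rule exI[of _ N\<^sub>2])
          (use \<delta>(2)[rule_format, OF D] rest in simp)
    qed
    then show ?thesis using \<delta>(1) by blast
  qed
  moreover have "MPhi_hat_minus_plus \<subseteq> (Ba :: ((nat \<Rightarrow> 'a) \<Rightarrow> (nat \<Rightarrow> 'a)) set)"
    by (auto simp: MPhi_hat_minus_plus_def)
  ultimately show ?thesis
    unfolding Ba_topology_def B.openin_mtopology by blast
qed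

end
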